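(* Let $\mathcal{P}$ be the set of prime numbers and let $\mathcal{P}_{\mathrm{good}}$ be the set of good primes (as defined in the context). Then $$\lim_{X\to\infty}\frac{\#\left(\mathcal{P}_{\mathrm{good}}\cap[0,X]\right)}{\#\left(\mathcal{P}\cap[0,X]\right)}=1 .$$
   Context: Logarithms and exponentials are natural; $\exp\exp(x)=e^{e^x}$. **Linear recurrence sequences.** An (integer) linear recurrence sequence (LRS) $\mathbf{u}=\langle u_n\rangle_{n=0}^\infty$ is a sequence of integers satisfying $u_{n+k}=a_1u_{n+k-1}+\cdots+a_ku_n$ for all $n\ge 0$, where $k\ge 1$, $a_1,\ldots,a_k\in\mathbb{Z}$ and $a_k\neq 0$; it is given by the data $k,a_1,\ldots,a_k,u_0,\ldots,u_{k-1}$. It is non-degenerate if it is not identically zero and, in its minimal recurrence (the one of least order), no quotient of two distinct roots of the characteristic polynomial is a root of unity. Its height is $H_{\mathbf{u}}:=\max\{k,|a_1|,\ldots,|a_k|,|u_0|,\ldots,|u_{k-1}|\}$. **Standing convention.** An absolute constant $C_0\ge 12$ is fixed; in the definition of bad primes below, all LRS considered are non-degenerate and have height greater than $C_0$. **Associated data.** Let $\mathbf{u}$ be such an LRS, let $\alpha_1,\ldots,\alpha_s$ be the distinct roots of the characteristic polynomial $x^k-a_1x^{k-1}-\cdots-a_k$, with multiplicities $\mu_1,\ldots,\mu_s$, and let $\mathbb{K}=\mathbb{Q}(\alpha_1,\ldots,\alpha_s)$. Write $u_t=\sum_{i=1}^sQ_i(t)\alpha_i^t$ for all $t\ge 0$,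 with $Q_i\in\mathbb{K}[t]$ of degree at most $\mu_i-1$. Let $\Delta$ be the determinant of the $k\times k$ matrix made of $s$ consecutive blocks, where the $\ell$-th block is the $k\times\mu_\ell$ matrix with $(i,j)$ entry $(i-1)^{j-1}\alpha_\ell^{i-1}$ for $1\le i\le k$, $1\le j\le\mu_\ell$ (with $0^0=1$). Then $\Delta^2\in\mathbb{Z}$. Put $P_i(t):=\Delta^2Q_i(t)$, a polynomial whose coefficients are algebraic integers of $\mathbb{K}$. For a permutation $\sigma\in\Sigma_s$ of $\{1,\ldots,s\}$, put $\beta_i:=\alpha_{\sigma(i)}$, and for an integer $m\ge 0$ define the algebraic integer $v_{m,\sigma}:=\sum_{i=1}^sP_i(m)\beta_i\alpha_i^m$. **Smallness.** For $X>\exp\exp e$ a power of $2$, $\mathbf{u}$ is small at level $X$ if $H_{\mathbf{u}}<\dfrac{\log\log X}{10\log\log\log X}$. **Bad and good primes.** A prime $P>\exp\exp e$ is bad if there exist a power of two $X$ with $X/2<P<X$, an LRS $\mathbf{u}$ (as in the standing convention) which is small at level $X$, a permutation $\sigma\in\Sigma_s$, and an integer $m\in[0,X^{1/4}]$ such that $v_{m,\sigma}\ne 0$ and $P$ divides the norm $\mathcal{N}_{\mathbb{K}/\mathbb{Q}}(v_{m,\sigma})=\prod_{\tau\in\mathrm{Gal}(\mathbb{K}/\mathbb{Q})}\tau(v_{m,\sigma})$. For $X>\exp\exp e$ a power of $2$, $\mathcal{P}_{\mathrm{bad}}(X)$ is the set of bad primes in $[X/2,X]$; $\mathcal{P}_{\mathrm{bad}}:=\bigcup_k\mathcal{P}_{\mathrm{bad}}(2^k)$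 over positive integers $k$ with $2^k>\exp\exp e$; and $\mathcal{P}_{\mathrm{good}}:=\mathcal{P}\setminus\mathcal{P}_{\mathrm{bad}}$. *)

theory Defs
  imports Complex_Main
    "HOL-Computational_Algebra.Primes"
    "HOL-Computational_Algebra.Polynomial"
    "HOL-Combinatorics.Permutations"
    "HOL-Library.FuncSet"
    "Jordan_Normal_Form.Determinant"
begin

(* An LRS is given by its order k, coefficients a 1, ..., a k and the sequence u itself;
   the values of a outside {1..k} are irrelevant. *)
definition lrs :: "nat \<Rightarrow> (nat \<Rightarrow> int) \<Rightarrow> (nat \<Rightarrow> int) \<Rightarrow> bool" where
  "lrs k a u \<longleftrightarrow> k \<ge> 1 \<and> a k \<noteq> 0 \<and> (\<forall>n. u (n + k) = (\<Sum>j=1..k. a j * u (n + k - j)))"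

definition lrs_height :: "nat \<Rightarrow> (nat \<Rightarrow> int) \<Rightarrow> (nat \<Rightarrow> int) \<Rightarrow> int" where
  "lrs_height k a u = Max ({int k} \<union> (\<lambda>j. \<bar>a j\<bar>) ` {1..k} \<union> (\<lambda>j. \<bar>u j\<bar>) ` {..<k})"

definition lrs_char_poly :: "nat \<Rightarrow> (nat \<Rightarrow> int) \<Rightarrow> complex poly" where
  "lrs_char_poly k a =
     Polynomial.monom 1 k - (\<Sum>j=1..k. Polynomial.monom (of_int (a j)) (k - j))"

definition lrs_roots :: "nat \<Rightarrow> (nat \<Rightarrow> int) \<Rightarrow> complex set" where
  "lrs_roots k a = {z. poly (lrs_char_poly k a) z = 0}"

definition minimal_recurrence :: "nat \<Rightarrow> (nat \<Rightarrow> int) \<Rightarrow> (nat \<Rightarrow> int) \<Rightarrow> bool" where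
  "minimal_recurrence k a u \<longleftrightarrow> lrs k a u \<and> (\<forall>k' a'. lrs k' a' u \<longrightarrow> k \<le> k')"

definition root_of_unity :: "complex \<Rightarrow> bool" where
  "root_of_unity z \<longleftrightarrow> (\<exists>n::nat. n \<ge> 1 \<and> z ^ n = 1)"

definition nondegenerate :: "(nat \<Rightarrow> int) \<Rightarrow> bool" where
  "nondegenerate u \<longleftrightarrow> (\<exists>n. u n \<noteq> 0) \<and>
     (\<forall>k a. minimal_recurrence k a u \<longrightarrow>
        (\<forall>x\<in>lrs_roots k a. \<forall>y\<in>lrs_roots k a. x \<noteq> y \<longrightarrow> \<not> root_of_unity (x / y)))"

definition is_subfield :: "complex set \<Rightarrow> bool" where
  "is_subfield F \<longleftrightarrow> 0 \<in> F \<and> 1 \<in> F \<and>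
     (\<forall>x\<in>F. \<forall>y\<in>F. x + y \<in> F \<and> x * y \<in> F) \<and> (\<forall>x\<in>F. - x \<in> F \<and> inverse x \<in> F)"

(* Every subfield of the complex numbers contains the rationals, so this is Q(S). *)
definition adjoin :: "complex set \<Rightarrow> complex set" where
  "adjoin S = \<Inter>{F. is_subfield F \<and> S \<subseteq> F}"

(* Automorphisms of K over the rationals; extensionality gives each of them a unique
   representative as a function on the whole type. *)
definition galois_group :: "complex set \<Rightarrow> (complex \<Rightarrow> complex) set" where
  "galois_group K = {\<tau> \<in> extensional K. bij_betw \<tau> K K \<and>
     (\<forall>x\<in>K. \<forall>y\<in>K. \<tau> (x + y) = \<tau> x + \<tau> y \<and> \<tau> (x * y) = \<tau> x * \<tau> y) \<and>
     (\<forall>q\<in>\<rat>. \<tau> q = q)}"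

definition field_norm :: "complex set \<Rightarrow> complex \<Rightarrow> complex" where
  "field_norm K v = (\<Prod>\<tau>\<in>galois_group K. \<tau> v)"

definition lrs_mult :: "nat \<Rightarrow> (nat \<Rightarrow> int) \<Rightarrow> complex \<Rightarrow> nat" where
  "lrs_mult k a z = Polynomial.order z (lrs_char_poly k a)"

definition root_enumeration ::
  "nat \<Rightarrow> (nat \<Rightarrow> int) \<Rightarrow> nat \<Rightarrow> (nat \<Rightarrow> complex) \<Rightarrow> bool" where
  "root_enumeration k a s \<alpha> \<longleftrightarrow> bij_betw \<alpha> {1..s} (lrs_roots k a)"

(* The polynomials Q 1, ..., Q s exist and are uniquely determined by this predicate. *)
definition exp_poly_form :: "nat \<Rightarrow> (nat \<Rightarrow> int) \<Rightarrow> (nat \<Rightarrow> int) \<Rightarrow>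
    nat \<Rightarrow> (nat \<Rightarrow> complex) \<Rightarrow> (nat \<Rightarrow> complex poly) \<Rightarrow> bool" where
  "exp_poly_form k a u s \<alpha> Q \<longleftrightarrow>
     (\<forall>i\<in>{1..s}. Polynomial.degree (Q i) \<le> lrs_mult k a (\<alpha> i) - 1 \<and>
        (\<forall>n. Polynomial.coeff (Q i) n \<in> adjoin (lrs_roots k a))) \<and>
     (\<forall>t. of_int (u t) = (\<Sum>i=1..s. poly (Q i) (of_nat t) * \<alpha> i ^ t))"

(* Rows and the columns inside each block are numbered from 0. *)
definition lrs_Delta :: "nat \<Rightarrow> (nat \<Rightarrow> int) \<Rightarrow> nat \<Rightarrow> (nat \<Rightarrow> complex) \<Rightarrow> complex" where
  "lrs_Delta k a s \<alpha> = det (mat_of_cols k (concat (map (\<lambda>l.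
     map (\<lambda>j. vec k (\<lambda>i. of_nat i ^ j * \<alpha> l ^ i)) [0..<lrs_mult k a (\<alpha> l)]) [1..<Suc s])))"

definition lrs_v :: "nat \<Rightarrow> (nat \<Rightarrow> int) \<Rightarrow> nat \<Rightarrow> (nat \<Rightarrow> complex) \<Rightarrow>
    (nat \<Rightarrow> complex poly) \<Rightarrow> nat \<Rightarrow> (nat \<Rightarrow> nat) \<Rightarrow> complex" where
  "lrs_v k a s \<alpha> Q m \<sigma> =
     (let P = (\<lambda>i. Polynomial.smult ((lrs_Delta k a s \<alpha>)\<^sup>2) (Q i));
          \<beta> = (\<lambda>i. \<alpha> (\<sigma> i))
      in \<Sum>i=1..s. poly (P i) (of_nat m) * \<beta> i * \<alpha> i ^ m)"

definition small_at :: "real \<Rightarrow> nat \<Rightarrow> (nat \<Rightarrow> int) \<Rightarrow> (nat \<Rightarrow> int) \<Rightarrow> bool" where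
  "small_at X k a u \<longleftrightarrow> of_int (lrs_height k a u) < ln (ln X) / (10 * ln (ln (ln X)))"

(* The norm is a rational integer; divisibility is stated for that integer. *)
definition bad_prime :: "real \<Rightarrow> nat \<Rightarrow> bool" where
  "bad_prime C\<^sub>0 p \<longleftrightarrow> prime p \<and> real p > exp (exp (exp 1)) \<and>
     (\<exists>X::real. (\<exists>e::nat. X = 2 ^ e) \<and> X / 2 < real p \<and> real p < X \<and>
       (\<exists>k a u. lrs k a u \<and> nondegenerate u \<and> of_int (lrs_height k a u) > C\<^sub>0 \<and> small_at X k a u \<and>
         (\<exists>s \<alpha> Q. root_enumeration k a s \<alpha> \<and> exp_poly_form k a u s \<alpha> Q \<and>
           (\<exists>\<sigma> m. \<sigma> permutes {1..s} \<and> real m \<le> X powr (1/4) \<and> lrs_v k a s \<alpha> Q m \<sigma> \<noteq> 0 \<and>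
             (\<exists>N::int. field_norm (adjoin (lrs_roots k a)) (lrs_v k a s \<alpha> Q m \<sigma>) = of_int N \<and>
                int p dvd N)))))"

definition bad_primes_at :: "real \<Rightarrow> real \<Rightarrow> nat set" where
  "bad_primes_at C\<^sub>0 X = {p. bad_prime C\<^sub>0 p \<and> X / 2 \<le> real p \<and> real p \<le> X}"

definition bad_primes :: "real \<Rightarrow> nat set" where
  "bad_primes C\<^sub>0 = (\<Union>e\<in>{e::nat. e \<ge> 1 \<and> (2::real) ^ e > exp (exp (exp 1))}. bad_primes_at C\<^sub>0 (2 ^ e))"

definition good_primes :: "real \<Rightarrow> nat set" where
  "good_primes C\<^sub>0 = {p. prime p} - bad_primes C\<^sub>0"

end

(* Counting argument. Fix a level X. The number of LRS that are small at level X, together with the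
   enumerations of their roots and the permutations, is X^o(1), and m takes at most X^(1/4) + 1 values.
   For each choice, v is an explicit integer polynomial in the roots (Cramer's rule; the factor Delta^2
   clears the denominators), so every conjugate of v is the same expression in the permuted roots and has
   logarithm at most X^(1/4 + o(1)). There are X^o(1) conjugates, hence a nonzero norm has at most
   X^(1/4 + o(1)) prime divisors and there are at most X^(1/2 + o(1)) bad primes at level X. The number of
   all primes up to X is at least a constant times X / log X by Chebyshev's bound, obtained from
   2^(n-2) <= lcm(1, ..., n) <= n^pi(n). *)

theory Submission
  imports Defs "HOL-Real_Asymp.Real_Asymp"
begin

section \<open>Prime divisors and Chebyshev's lower bound\<close>

text \<open>The range of m is paid for twice, once as a parameter and once through the factors
  \<alpha> i ^ m in the size of v; this is how the exponent 1/4 becomes 1/2. Everything that depends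
  on the height alone is collected into h ^ (10 * h), and the smallness condition, with its constant
  10, bounds this by ln X.

  The obstacle is that the definition of a bad prime quantifies over infinite families: sequences,
  coefficient functions and enumerations on all of nat, and polynomials Q over the splitting field.
  Cramer's rule eliminates Q: each coefficient times Delta is a determinant in the roots and the
  initial values, and the other factor of Delta^2 is the determinant of the linear system itself.
  What remains depends on finitely many integers and roots, so restricting every function to its
  relevant arguments leaves a finite family to count.\<close>

lemma card_prime_divisors_le:
  fixes n :: nat
  assumes "n > 0" "n \<le> 2 ^ d"
  shows "card {p. prime p \<and> p dvd n} \<le> d"
proof -
  have eq: "{p. prime p \<and> p dvd n} = prime_factors n"
    using assms by (auto simp: prime_factors_dvd)
  have "(2::nat) ^ card (prime_factors n) = (\<Prod>p\<in>prime_factors n. 2)"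
    by simp
  also have "\<dots> \<le> (\<Prod>p\<in>prime_factors n. p ^ multiplicity p n)"
  proof (rule prod_mono, safe)
    fix p assume p: "p \<in># prime_factorization n"
    then have "p \<ge> 2" "multiplicity p n \<ge> 1"
      by (auto simp: prime_factors_multiplicity dest: prime_ge_2_nat)
    then show "2 \<le> p ^ multiplicity p n"
      using self_le_power[of p "multiplicity p n"] by linarith
  qed
  also have "\<dots> = n"
    using assms(1) prime_factorization_nat by metis
  finally have "(2::nat) ^ card (prime_factors n) \<le> 2 ^ d"
    using assms(2) by linarith
  then show ?thesis unfolding eq by simp
qed

text \<open>Induction on n - k: the pairs (n - 1, k) and (n, k + 1) both have a smaller difference,
  and the reciprocal of k C(n,k) is the difference of the reciprocals belonging to them.\<close>

lemma mult_binomial_dvd_Lcm: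
  fixes n k :: nat
  assumes "1 \<le> k" "k \<le> n"
  shows "k * (n choose k) dvd Lcm {1..n}"
  using assms
proof (induction "n - k" arbitrary: n k)
  case 0
  then show ?case by (auto intro!: dvd_Lcm)
next
  case (Suc d)
  define L where "L = Lcm {1..n}"
  obtain n' where n': "n = Suc n'" using Suc by (cases n) auto
  have "k * (n' choose k) dvd Lcm {1..n'}"
    using Suc n' by (intro Suc(1)) auto
  also have "\<dots> dvd L" unfolding L_def n' by (intro Lcm_subset) auto
  finally obtain x where x: "L = k * (n' choose k) * x" by (auto elim: dvdE)
  have "Suc k * (n choose Suc k) dvd L"
    unfolding L_def using Suc by (intro Suc(1)) auto
  then obtain y where y: "L = Suc k * (n choose Suc k) * y" by (auto elim: dvdE)
  have c: "n' choose k > 0" using Suc n' by auto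
  have nk: "n > k" "k \<ge> 1" using Suc by auto
  have e1: "(n - k) * (n choose k) = n * (n' choose k)"
    using binomial_absorb_comp[of n k] n' by simp
  have e2: "Suc k * (n choose Suc k) = n * (n' choose k)"
    using Suc_times_binomial[of k n'] n' by simp
  have e1': "(real n - real k) * real (n choose k) = real n * real (n' choose k)"
    using e1 nk by (metis of_nat_diff of_nat_mult less_imp_le)
  have L1: "real L = real k * real (n' choose k) * real x" using x by simp
  have L2: "real L = real n * real (n' choose k) * real y" using y e2 by simp
  have xy: "real k * real x = real n * real y"
    using L1 L2 c by simp
  \<comment> \<open>Leibniz's harmonic triangle: 1/(k C(n,k)) = 1/(k C(n-1,k)) - 1/((k+1) C(n,k+1)).\<close>
  have "real L = real k * real (n choose k) * (real x - real y)"
  proof -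
    have "(real n - real k) * (real k * real (n choose k) * (real x - real y))
       = real k * (real n * real (n' choose k)) * (real x - real y)"
      using e1' by (simp add: algebra_simps)
    also have "\<dots> = real (n' choose k) * (real n * (real k * real x) - real k * (real n * real y))"
      by (simp add: algebra_simps)
    also have "\<dots> = (real n - real k) * (real (n' choose k) * (real k * real x))"
      by (simp add: xy algebra_simps)
    also have "\<dots> = (real n - real k) * real L" using L1 by simp
    finally show ?thesis using nk by simp
  qed
  \<comment> \<open>Subtraction on nat is truncated, so the quotient x - y is formed in the integers
    and the divisibility is pulled back from there.\<close>
  then have "real_of_int (int L) = real_of_int (int (k * (n choose k)) * (int x - int y))"
    by simp
  then have "int L = int (k * (n choose k)) * (int x - int y)"
    using of_int_eq_iff by blast
  then have "int (k * (n choose k)) dvd int L" by simp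
  then show ?case unfolding L_def by (simp only: int_dvd_int_iff)
qed

text \<open>The multiplicity of p in an lcm is the maximum of its multiplicities in the entries, so
  p ^ e already divides one of the numbers 1, ..., n.\<close>

lemma prime_power_dvd_Lcm_imp_le:
  fixes p e n :: nat
  assumes "prime p" "p ^ e dvd Lcm {1..n}" "n \<ge> 1"
  shows "p ^ e \<le> n"
  using assms(3,2)
proof (induction n rule: nat_induct_at_least)
  case base
  then show ?case by (auto simp: prime_gt_0_nat)
next
  case (Suc n)
  have "Lcm {1..Suc n} = lcm (Suc n) (Lcm {1..n})"
    by (simp add: atLeastAtMostSuc_conv)
  then have "p ^ e dvd lcm (Suc n) (Lcm {1..n})" using Suc by simp
  moreover have "Lcm {1..n} \<noteq> 0" by (auto simp: Lcm_0_iff)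
  ultimately have "e \<le> multiplicity p (lcm (Suc n) (Lcm {1..n}))"
    using assms(1) by (intro multiplicity_geI) (auto simp: lcm_eq_0_iff)
  also have "\<dots> = max (multiplicity p (Suc n)) (multiplicity p (Lcm {1..n}))"
    using assms(1) \<open>Lcm {1..n} \<noteq> 0\<close> by (intro multiplicity_lcm) auto
  finally have "p ^ e dvd Suc n \<or> p ^ e dvd Lcm {1..n}"
    by (auto simp: max_def multiplicity_dvd' split: if_splits)
  then show ?case
    using Suc.IH by (auto dest: dvd_imp_le)
qed

text \<open>Each prime power in the factorization of the lcm is at most n, and only primes up to n
  occur.\<close>

lemma Lcm_le_power_card_primes:
  fixes n :: nat
  assumes "n \<ge> 1"
  shows "Lcm {1..n} \<le> n ^ card {p. prime p \<and> p \<le> n}"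
proof -
  define L where "L = Lcm {1..n}"
  have L: "L \<noteq> 0" unfolding L_def by (auto simp: Lcm_0_iff)
  have mp: "p ^ multiplicity p L \<le> n" if "prime p" for p
    using prime_power_dvd_Lcm_imp_le[OF that _ assms] by (simp add: L_def multiplicity_dvd)
  have "L = (\<Prod>p\<in>prime_factors L. p ^ multiplicity p L)"
    using L prime_factorization_nat by blast
  also have "\<dots> \<le> (\<Prod>p\<in>prime_factors L. n)"
    using mp by (intro prod_mono) auto
  also have "\<dots> = n ^ card (prime_factors L)" by simp
  also have "\<dots> \<le> n ^ card {p. prime p \<and> p \<le> n}"
  proof (rule power_increasing[OF card_mono])
    show "prime_factors L \<subseteq> {p. prime p \<and> p \<le> n}"
    proof safe
      fix p assume p: "p \<in># prime_factorization L"
      then have "prime p" "multiplicity p L \<ge> 1"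
        by (auto simp: prime_factors_multiplicity)
      then show "p \<le> n"
        using mp[of p] self_le_power[of p "multiplicity p L"] prime_ge_1_nat[of p] by linarith
    qed auto
  qed (use assms in \<open>auto intro: finite_subset[of _ "{..n}"]\<close>)
  finally show ?thesis unfolding L_def .
qed

lemma card_primes_lower_bound:
  fixes n :: nat
  assumes "n \<ge> 2"
  shows "(real n - 2) * ln 2 \<le> real (card {p. prime p \<and> p \<le> n}) * ln (real n)"
proof -
  define m where "m = n div 2"
  have m: "m \<ge> 1" "2 * m \<le> n" "n \<le> 2 * m + 1" using assms unfolding m_def by auto
  have Lp: "Lcm {1..n} > 0" by (intro Nat.gr0I) (simp add: Lcm_0_iff)
  have "m * (2 * m choose m) dvd Lcm {1..2*m}"
    using m by (intro mult_binomial_dvd_Lcm) auto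
  also have "\<dots> dvd Lcm {1..n}" using m by (intro Lcm_subset) auto
  finally have "m * (2 * m choose m) \<le> Lcm {1..n}"
    using Lp by (rule dvd_imp_le)
  also have "\<dots> \<le> n ^ card {p. prime p \<and> p \<le> n}"
    using assms by (intro Lcm_le_power_card_primes) auto
  finally have "real (m * (2 * m choose m)) \<le> real (n ^ card {p. prime p \<and> p \<le> n})"
    by (rule of_nat_mono)
  \<comment> \<open>The factor m gained in the divisibility cancels the 1/m of the central binomial
    bound, which leaves 4 ^ m / 2 = 2 ^ (2 * m - 1), and 2 * m - 1 is at least n - 2.\<close>
  moreover have "4 ^ m / (2 * real m) \<le> real (2 * m choose m)"
    using m by (intro central_binomial_lower_bound) auto
  then have "4 ^ m / 2 \<le> real (m * (2 * m choose m))"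
    using m by (simp add: field_simps)
  ultimately have "4 ^ m / 2 \<le> real n ^ card {p. prime p \<and> p \<le> n}" by simp
  then have "ln (4 ^ m / 2) \<le> ln (real n ^ card {p. prime p \<and> p \<le> n})"
    using assms by (subst ln_le_cancel_iff) auto
  also have "\<dots> = real (card {p. prime p \<and> p \<le> n}) * ln (real n)"
    using assms by (simp add: ln_realpow)
  also have "ln (4 ^ m / 2 :: real) = (2 * real m - 1) * ln 2"
    using ln_realpow[of 2 2] by (simp add: ln_div ln_realpow algebra_simps)
  finally show ?thesis
  proof (rule order_trans[rotated])
    show "(real n - 2) * ln 2 \<le> (2 * real m - 1) * ln 2"
      using m by (intro mult_right_mono) auto
  qed
qed

section \<open>Subfields and their automorphisms\<close>

lemma is_subfield_adjoin: "is_subfield (adjoin S)"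
  by (auto simp: adjoin_def is_subfield_def)

lemma adjoin_superset: "S \<subseteq> adjoin S"
  by (auto simp: adjoin_def)

lemma adjoin_least: "is_subfield F \<Longrightarrow> S \<subseteq> F \<Longrightarrow> adjoin S \<subseteq> F"
  by (auto simp: adjoin_def)

context
  fixes K :: "complex set"
  assumes K: "is_subfield K"
begin

lemma subfield_zero: "0 \<in> K" and subfield_one: "1 \<in> K"
  and subfield_add: "x \<in> K \<Longrightarrow> y \<in> K \<Longrightarrow> x + y \<in> K"
  and subfield_mult: "x \<in> K \<Longrightarrow> y \<in> K \<Longrightarrow> x * y \<in> K"
  and subfield_uminus: "x \<in> K \<Longrightarrow> - x \<in> K"
  and subfield_inverse: "x \<in> K \<Longrightarrow> inverse x \<in> K"
  using K by (auto simp: is_subfield_def)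

lemma subfield_sum: "(\<And>x. x \<in> A \<Longrightarrow> f x \<in> K) \<Longrightarrow> sum f A \<in> K"
  by (induction A rule: infinite_finite_induct) (auto intro: subfield_zero subfield_add)

lemma subfield_prod: "(\<And>x. x \<in> A \<Longrightarrow> f x \<in> K) \<Longrightarrow> prod f A \<in> K"
  by (induction A rule: infinite_finite_induct) (auto intro: subfield_one subfield_mult)

lemma subfield_power: "x \<in> K \<Longrightarrow> x ^ n \<in> K"
  by (induction n) (auto intro: subfield_one subfield_mult)

lemma subfield_of_nat: "of_nat n \<in> K"
  by (induction n) (auto intro: subfield_zero subfield_one subfield_add)

lemma subfield_of_int: "of_int n \<in> K"
  by (cases n rule: int_cases2) (auto intro: subfield_of_nat subfield_uminus)

lemma subfield_signof: "signof p \<in> K"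
  by (auto simp: sign_def intro: subfield_one subfield_uminus)

lemma subfield_det:
  assumes "A \<in> carrier_mat n n" "\<And>i j. i < n \<Longrightarrow> j < n \<Longrightarrow> A $$ (i, j) \<in> K"
  shows "det A \<in> K"
  unfolding det_def'[OF assms(1)]
  using assms(2) permutes_in_image
  by (intro subfield_sum subfield_mult subfield_prod subfield_signof) force

context
  fixes \<tau> :: "complex \<Rightarrow> complex"
  assumes \<tau>: "\<tau> \<in> galois_group K"
begin

lemma galois_add: "x \<in> K \<Longrightarrow> y \<in> K \<Longrightarrow> \<tau> (x + y) = \<tau> x + \<tau> y"
  and galois_mult: "x \<in> K \<Longrightarrow> y \<in> K \<Longrightarrow> \<tau> (x * y) = \<tau> x * \<tau> y"
  and galois_Rats: "q \<in> \<rat> \<Longrightarrow> \<tau> q = q"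
  and galois_bij: "bij_betw \<tau> K K"
  using \<tau> by (auto simp: galois_group_def bij_betw_def)

lemma galois_zero: "\<tau> 0 = 0" and galois_one: "\<tau> 1 = 1"
  and galois_of_nat: "\<tau> (of_nat n) = of_nat n" and galois_of_int: "\<tau> (of_int i) = of_int i"
  by (auto intro: galois_Rats)

lemma galois_uminus: "x \<in> K \<Longrightarrow> \<tau> (- x) = - \<tau> x"
  using galois_add[of x "- x"] subfield_uminus[of x]
  by (simp add: galois_zero add_eq_0_iff)

lemma galois_inverse:
  assumes "x \<in> K"
  shows "\<tau> (inverse x) = inverse (\<tau> x)"
proof (cases "x = 0")
  case False
  then have "\<tau> x * \<tau> (inverse x) = 1"
    using galois_mult[OF assms subfield_inverse[OF assms]] by (simp add: galois_one)
  then show ?thesis by (metis inverse_unique)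
qed (simp add: galois_zero)

lemma galois_nonzero: "x \<in> K \<Longrightarrow> x \<noteq> 0 \<Longrightarrow> \<tau> x \<noteq> 0"
  using galois_bij galois_zero subfield_zero by (metis bij_betw_def inj_on_def)

lemma galois_sum: "(\<And>x. x \<in> A \<Longrightarrow> f x \<in> K) \<Longrightarrow> \<tau> (sum f A) = (\<Sum>x\<in>A. \<tau> (f x))"
  by (induction A rule: infinite_finite_induct) (auto simp: galois_zero galois_add subfield_sum)

lemma galois_prod: "(\<And>x. x \<in> A \<Longrightarrow> f x \<in> K) \<Longrightarrow> \<tau> (prod f A) = (\<Prod>x\<in>A. \<tau> (f x))"
  by (induction A rule: infinite_finite_induct) (auto simp: galois_one galois_mult subfield_prod)

lemma galois_power: "x \<in> K \<Longrightarrow> \<tau> (x ^ n) = \<tau> x ^ n"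
  by (induction n) (auto simp: galois_one galois_mult subfield_power)

lemma galois_signof: "\<tau> (signof p) = signof p"
  by (auto simp: sign_def galois_one galois_uminus subfield_one)

text \<open>The Leibniz formula is a polynomial in the entries with coefficients 1 and -1, which
  every automorphism fixes.\<close>

lemma galois_det:
  assumes A: "A \<in> carrier_mat n n" "\<And>i j. i < n \<Longrightarrow> j < n \<Longrightarrow> A $$ (i, j) \<in> K"
  shows "\<tau> (det A) = det (map_mat \<tau> A)"
proof -
  have p: "p i < n" if "p permutes {0..<n}" "i < n" for p i
    using permutes_in_image[OF that(1), of i] that(2) by simp
  have inK: "A $$ (i, p i) \<in> K" if "p permutes {0..<n}" "i < n" for p i
    using A(2) p that by simp
  have "\<tau> (det A) = (\<Sum>p | p permutes {0..<n}. \<tau> (signof p * (\<Prod>i = 0..<n. A $$ (i, p i))))"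
    unfolding det_def'[OF A(1)]
    by (intro galois_sum subfield_mult subfield_signof subfield_prod) (simp add: inK)
  also have "\<dots> = (\<Sum>p | p permutes {0..<n}. signof p * (\<Prod>i = 0..<n. map_mat \<tau> A $$ (i, p i)))"
  proof (rule sum.cong, simp, clarify)
    fix p assume P: "p permutes {0..<n}"
    have "\<tau> (\<Prod>i = 0..<n. A $$ (i, p i)) = (\<Prod>i = 0..<n. \<tau> (A $$ (i, p i)))"
      using inK[OF P] by (intro galois_prod) simp
    also have "\<dots> = (\<Prod>i = 0..<n. map_mat \<tau> A $$ (i, p i))"
      using A(1) p[OF P] by (intro prod.cong) auto
    finally show "\<tau> (signof p * (\<Prod>i = 0..<n. A $$ (i, p i))) =
        signof p * (\<Prod>i = 0..<n. map_mat \<tau> A $$ (i, p i))"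
      using inK[OF P] by (subst galois_mult) (auto simp: galois_signof intro: subfield_signof subfield_prod)
  qed
  also have "\<dots> = det (map_mat \<tau> A)"
    using A(1) by (subst det_def'[of _ n]) auto
  finally show ?thesis .
qed

end

end

section \<open>The value v as a polynomial in the roots\<close>

text \<open>The confluent Vandermonde matrix behind \<open>lrs_Delta\<close>. The block structure is
  moved into \<open>ix\<close>, which sends a column to its pair (block, exponent), so that the
  roots enter through \<alpha> alone.\<close>

definition confluent :: "nat \<Rightarrow> (nat \<Rightarrow> nat \<times> nat) \<Rightarrow> (nat \<Rightarrow> complex) \<Rightarrow> complex mat" where
  "confluent k ix \<alpha> = mat k k (\<lambda>(i, c). of_nat i ^ snd (ix c) * \<alpha> (fst (ix c)) ^ i)"

text \<open>By Cramer's rule this is v when \<open>ix\<close> lists the pairs (root index, exponent) of the columns; but it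
  only involves integers and roots, so automorphisms act on it through the roots alone.\<close>

definition cramer_v ::
  "nat \<Rightarrow> (nat \<Rightarrow> nat \<times> nat) \<Rightarrow> (nat \<Rightarrow> int) \<Rightarrow> nat \<Rightarrow> (nat \<Rightarrow> complex) \<Rightarrow> (nat \<Rightarrow> complex) \<Rightarrow> complex"
  where
  "cramer_v k ix u m \<alpha> \<beta> = det (confluent k ix \<alpha>) *
     (\<Sum>n<k. det (replace_col (confluent k ix \<alpha>) (vec k (\<lambda>i. of_int (u i))) n) *
        (of_nat m ^ snd (ix n) * \<beta> (fst (ix n)) * \<alpha> (fst (ix n)) ^ m))"

lemma confluent_carrier [simp]: "confluent k ix \<alpha> \<in> carrier_mat k k"
  by (simp add: confluent_def)

lemma replace_col_confluent:
  "replace_col (confluent k ix \<alpha>) (vec k (\<lambda>i. of_int (u i))) n =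
     mat k k (\<lambda>(i, c). if c = n then of_int (u i) else of_nat i ^ snd (ix c) * \<alpha> (fst (ix c)) ^ i)"
  by (rule eq_matI) (auto simp: replace_col_def confluent_def)

text \<open>This permits replacing arbitrary functions on nat by their restrictions to finite sets,
  of which there are only finitely many.\<close>

lemma cramer_v_cong:
  assumes "\<And>n. n < k \<Longrightarrow> ix n = ix' n"
    and "\<And>i. i < k \<Longrightarrow> u i = u' i"
    and "\<And>n. n < k \<Longrightarrow> \<alpha> (fst (ix n)) = \<alpha>' (fst (ix n))"
    and "\<And>n. n < k \<Longrightarrow> \<beta> (fst (ix n)) = \<beta>' (fst (ix n))"
  shows "cramer_v k ix u m \<alpha> \<beta> = cramer_v k ix' u' m \<alpha>' \<beta>'"
proof -
  have "confluent k ix \<alpha> = confluent k ix' \<alpha>'"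
    using assms by (intro eq_matI) (auto simp: confluent_def)
  moreover have "vec k (\<lambda>i. of_int (u i) :: complex) = vec k (\<lambda>i. of_int (u' i))"
    using assms by (intro eq_vecI) auto
  ultimately show ?thesis
    unfolding cramer_v_def using assms
    by (intro arg_cong2[where f="(*)"] sum.cong) auto
qed

context
  fixes K :: "complex set" and k :: nat and ix :: "nat \<Rightarrow> nat \<times> nat" and \<alpha> \<beta> :: "nat \<Rightarrow> complex"
  assumes K: "is_subfield K"
    and \<alpha>: "\<And>n. n < k \<Longrightarrow> \<alpha> (fst (ix n)) \<in> K"
    and \<beta>: "\<And>n. n < k \<Longrightarrow> \<beta> (fst (ix n)) \<in> K"
begin

lemma det_confluent_in: "det (confluent k ix \<alpha>) \<in> K"
  by (rule subfield_det[OF K confluent_carrier])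
     (auto simp: confluent_def intro!: subfield_mult subfield_power subfield_of_nat K \<alpha>)

lemma det_replace_confluent_in:
  "det (replace_col (confluent k ix \<alpha>) (vec k (\<lambda>i. of_int (u i))) n) \<in> K"
  unfolding replace_col_confluent
  by (rule subfield_det[OF K, of _ k])
     (auto intro!: subfield_mult subfield_power subfield_of_nat subfield_of_int K \<alpha>)

lemma cramer_v_in: "cramer_v k ix u m \<alpha> \<beta> \<in> K"
  unfolding cramer_v_def
  by (intro subfield_mult subfield_sum subfield_power subfield_of_nat K \<alpha> \<beta>
       det_confluent_in det_replace_confluent_in) auto

lemma galois_cramer_v:
  assumes \<tau>: "\<tau> \<in> galois_group K"
  shows "\<tau> (cramer_v k ix u m \<alpha> \<beta>) = cramer_v k ix u m (\<tau> \<circ> \<alpha>) (\<tau> \<circ> \<beta>)"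
proof -
  note hom = galois_mult[OF K \<tau>] galois_power[OF K \<tau>] galois_of_nat[OF K \<tau>] galois_of_int[OF K \<tau>]
  note mem = subfield_mult[OF K] subfield_power[OF K] subfield_of_nat[OF K] subfield_of_int[OF K]
  have d1: "\<tau> (det (confluent k ix \<alpha>)) = det (confluent k ix (\<tau> \<circ> \<alpha>))"
  proof (subst galois_det[OF K \<tau> confluent_carrier])
    show "det (map_mat \<tau> (confluent k ix \<alpha>)) = det (confluent k ix (\<tau> \<circ> \<alpha>))"
      by (intro arg_cong[where f=det] eq_matI) (auto simp: confluent_def hom mem \<alpha>)
  qed (auto simp: confluent_def mem \<alpha>)
  have d2: "\<tau> (det (replace_col (confluent k ix \<alpha>) (vec k (\<lambda>i. of_int (u i))) n)) =
      det (replace_col (confluent k ix (\<tau> \<circ> \<alpha>)) (vec k (\<lambda>i. of_int (u i))) n)" for n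
    unfolding replace_col_confluent
  proof (subst galois_det[OF K \<tau>, of _ k])
    show "det (map_mat \<tau> (mat k k (\<lambda>(i, c). if c = n then of_int (u i)
           else of_nat i ^ snd (ix c) * \<alpha> (fst (ix c)) ^ i))) =
         det (mat k k (\<lambda>(i, c). if c = n then of_int (u i)
           else of_nat i ^ snd (ix c) * (\<tau> \<circ> \<alpha>) (fst (ix c)) ^ i))"
      by (intro arg_cong[where f=det] eq_matI) (auto simp: hom mem \<alpha>)
  qed (auto simp: mem \<alpha>)
  show ?thesis
    \<comment> \<open>Read backwards, \<open>d1\<close> and \<open>d2\<close> turn the determinants
      on the right into images under \<tau>, so only sums, products and powers remain to be
      matched.\<close>
    unfolding cramer_v_def d1[symmetric] d2[symmetric]
    by (subst galois_mult[OF K \<tau>] galois_sum[OF K \<tau>];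
        (intro mem subfield_sum[OF K] det_confluent_in det_replace_confluent_in \<alpha> \<beta>)?;
        simp add: galois_sum[OF K \<tau>] hom mem det_confluent_in det_replace_confluent_in \<alpha> \<beta>)+
qed

end

section \<open>Archimedean size of v\<close>

lemma norm_det_le:
  fixes A :: "complex mat"
  assumes A: "A \<in> carrier_mat n n" and E: "\<And>i j. i < n \<Longrightarrow> j < n \<Longrightarrow> norm (A $$ (i, j)) \<le> E"
  shows "norm (det A) \<le> fact n * E ^ n"
proof -
  have "norm (det A) \<le> (\<Sum>p | p permutes {0..<n}. E ^ n)"
    unfolding det_def'[OF A]
  proof (rule sum_norm_le, clarify)
    fix p assume p: "p permutes {0..<n}"
    have "norm (\<Prod>i = 0..<n. A $$ (i, p i)) \<le> (\<Prod>i = 0..<n. E)"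
      unfolding prod_norm[symmetric] using permutes_in_image[OF p]
      by (intro prod_mono conjI norm_ge_zero E) auto
    then show "norm (signof p * (\<Prod>i = 0..<n. A $$ (i, p i))) \<le> E ^ n"
      by (auto simp: norm_mult sign_def)
  qed
  also have "\<dots> = fact n * E ^ n"
    by (simp add: card_permutations)
  finally show ?thesis .
qed

text \<open>The exponent must be linear in m: after the union over m <= M it yields a total of order
  M ^ 2. Each determinant contributes h ^ (4 * h ^ 2), namely h ^ (h ^ 2) for the factorial and h ^
  (3 * h ^ 2) for a product of entries bounded by h ^ (3 * h).\<close>

lemma norm_cramer_v_le:
  fixes h :: nat
  assumes k: "k \<le> h" and h: "h \<ge> 2"
    and ix: "\<And>n. n < k \<Longrightarrow> snd (ix n) \<le> k"
    and u: "\<And>i. i < k \<Longrightarrow> \<bar>u i\<bar> \<le> int h"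
    and \<alpha>: "\<And>n. n < k \<Longrightarrow> norm (\<alpha> (fst (ix n))) \<le> real h ^ 2"
    and \<beta>: "\<And>n. n < k \<Longrightarrow> norm (\<beta> (fst (ix n))) \<le> real h ^ 2"
  shows "norm (cramer_v k ix u m \<alpha> \<beta>) \<le> 2 ^ (15 * h ^ 3 * (m + 1))"
proof -
  have h1: "real h \<ge> 1" using h by simp
  have ent: "norm (of_nat i ^ snd (ix c) * \<alpha> (fst (ix c)) ^ i) \<le> real h ^ (3 * h)"
    if "i < k" "c < k" for i c
  proof -
    have "real i ^ snd (ix c) \<le> real h ^ snd (ix c)"
      using that k by (intro power_mono) auto
    also have "\<dots> \<le> real h ^ h"
      using ix[OF that(2)] k h1 by (intro power_increasing) auto
    finally have 1: "real i ^ snd (ix c) \<le> real h ^ h" .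
    have "norm (\<alpha> (fst (ix c))) ^ i \<le> (real h ^ 2) ^ i"
      using \<alpha>[OF that(2)] by (intro power_mono) auto
    also have "\<dots> \<le> (real h ^ 2) ^ h"
      using that k h1 by (intro power_increasing) auto
    finally have 2: "norm (\<alpha> (fst (ix c))) ^ i \<le> real h ^ (2 * h)"
      by (simp add: power_mult)
    have "norm (of_nat i ^ snd (ix c) * \<alpha> (fst (ix c)) ^ i) = real i ^ snd (ix c) * norm (\<alpha> (fst (ix c))) ^ i"
      by (simp add: norm_mult norm_power)
    also have "\<dots> \<le> real h ^ h * real h ^ (2 * h)"
      using 1 2 by (intro mult_mono) auto
    also have "\<dots> = real h ^ (3 * h)" by (simp flip: power_add)
    finally show ?thesis .
  qed
  have entu: "norm (of_int (u i) :: complex) \<le> real h ^ (3 * h)" if "i < k" for i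
  proof -
    have "norm (of_int (u i) :: complex) = real_of_int \<bar>u i\<bar>" by simp
    also have "\<dots> \<le> real_of_int (int h)" using u[OF that] by (intro of_int_le_iff[THEN iffD2])
    also have "\<dots> = real h ^ 1" by simp
    also have "\<dots> \<le> real h ^ (3 * h)" using h h1 by (intro power_increasing) auto
    finally show ?thesis .
  qed
  have D: "fact k * (real h ^ (3 * h)) ^ k \<le> real h ^ (4 * h ^ 2)"
  proof -
    have "fact k \<le> real k ^ k" using fact_le_power[of k, where 'a=real] by simp
    also have "\<dots> \<le> real h ^ k" using k by (intro power_mono) auto
    also have "\<dots> \<le> real h ^ (h ^ 2)"
    proof (rule power_increasing)
      show "k \<le> h ^ 2" using k self_le_power[of h 2] h by linarith
    qed (use h1 in auto)
    finally have 1: "fact k \<le> real h ^ (h ^ 2)" .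
    have "(real h ^ (3 * h)) ^ k \<le> (real h ^ (3 * h)) ^ h"
      using k h1 by (intro power_increasing one_le_power)
    also have "\<dots> = real h ^ (3 * h ^ 2)"
      by (simp add: power2_eq_square mult.assoc flip: power_mult)
    finally have 2: "(real h ^ (3 * h)) ^ k \<le> real h ^ (3 * h ^ 2)" .
    have "fact k * (real h ^ (3 * h)) ^ k \<le> real h ^ (h ^ 2) * real h ^ (3 * h ^ 2)"
      using 1 2 by (intro mult_mono) auto
    then show ?thesis by (simp flip: power_add)
  qed
  have d1: "norm (det (confluent k ix \<alpha>)) \<le> real h ^ (4 * h ^ 2)"
    by (rule order_trans[OF norm_det_le[OF confluent_carrier] D])
       (auto simp: confluent_def simp del: norm_mult norm_power norm_of_nat intro!: ent)
  have d2: "norm (det (replace_col (confluent k ix \<alpha>) (vec k (\<lambda>i. of_int (u i))) n)) \<le> real h ^ (4 * h ^ 2)" for n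
    unfolding replace_col_confluent
    by (rule order_trans[OF norm_det_le D])
       (auto intro!: ent entu simp del: norm_of_int norm_mult norm_power norm_of_nat)
  have t: "norm (of_nat m ^ snd (ix n) * \<beta> (fst (ix n)) * \<alpha> (fst (ix n)) ^ m)
      \<le> real (m + 1) ^ h * real h ^ (2 * m + 2)" if n: "n < k" for n
  proof -
    have "real m ^ snd (ix n) \<le> real (m + 1) ^ snd (ix n)" by (intro power_mono) auto
    also have "\<dots> \<le> real (m + 1) ^ h" using ix[OF n] k by (intro power_increasing) auto
    finally have 1: "real m ^ snd (ix n) \<le> real (m + 1) ^ h" .
    have "norm (\<alpha> (fst (ix n))) ^ m \<le> (real h ^ 2) ^ m"
      using \<alpha>[OF n] by (intro power_mono) auto
    then have "norm (of_nat m ^ snd (ix n) * \<beta> (fst (ix n)) * \<alpha> (fst (ix n)) ^ m)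
       \<le> (real (m + 1) ^ h * real h ^ 2) * (real h ^ 2) ^ m"
      unfolding norm_mult norm_power norm_of_nat
      by (intro mult_mono 1 \<beta>[OF n]) auto
    also have "\<dots> = real (m + 1) ^ h * real h ^ (2 * m + 2)"
      unfolding power_add power_mult by (simp only: mult_ac)
    finally show ?thesis .
  qed
  define T where "T = real (m + 1) ^ h * real h ^ (2 * m + 2)"
  have "norm (cramer_v k ix u m \<alpha> \<beta>) \<le> real h ^ (4 * h ^ 2) * (\<Sum>n<k. real h ^ (4 * h ^ 2) * T)"
    unfolding cramer_v_def norm_mult
  proof (intro mult_mono d1 sum_norm_le)
    fix n assume "n \<in> {..<k}"
    then have "n < k" by simp
    show "norm (det (replace_col (confluent k ix \<alpha>) (vec k (\<lambda>i. of_int (u i))) n) *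
        (of_nat m ^ snd (ix n) * \<beta> (fst (ix n)) * \<alpha> (fst (ix n)) ^ m)) \<le> real h ^ (4 * h ^ 2) * T"
      unfolding T_def norm_mult[of "det _"] by (intro mult_mono d2 t[OF \<open>n < k\<close>]) auto
  qed auto
  also have "\<dots> = real k * (real h ^ (4 * h ^ 2 + 4 * h ^ 2) * T)"
    unfolding power_add by simp
  also have "\<dots> = real k * (real h ^ (8 * h ^ 2 + 2 * m + 2) * real (m + 1) ^ h)"
    unfolding T_def by (simp add: power_add)
  also have "\<dots> \<le> real h * (real h ^ (8 * h ^ 2 + 2 * m + 2) * real (m + 1) ^ h)"
    using k by (intro mult_right_mono) auto
  also have "\<dots> = real h ^ (8 * h ^ 2 + 2 * m + 3) * real (m + 1) ^ h"
    by (simp add: power_add eval_nat_numeral)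
  \<comment> \<open>By h < 2 ^ h and m + 1 < 2 ^ (m + 1) everything becomes a power of 2 with
    exponent 8 h^3 + 3 h m + 4 h; the constant 15 is 8 + 3 + 4.\<close>
  also have "\<dots> \<le> (2 ^ h) ^ (8 * h ^ 2 + 2 * m + 3) * (2 ^ (m + 1)) ^ h"
    by (intro mult_mono power_mono less_imp_le[OF of_nat_less_two_power]) auto
  also have "\<dots> = 2 ^ (h * (8 * h ^ 2 + 2 * m + 3) + (m + 1) * h)"
    by (simp add: power_add power_mult)
  also have "\<dots> \<le> 2 ^ (15 * h ^ 3 * (m + 1))"
  proof (rule power_increasing)
    have hh: "h \<le> h ^ 3" using self_le_power[of h 3] h by linarith
    have "h * (8 * h ^ 2 + 2 * m + 3) + (m + 1) * h = 8 * h ^ 3 + 3 * (h * m) + 4 * h"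
      by (simp add: algebra_simps power3_eq_cube power2_eq_square)
    also have "\<dots> \<le> 8 * h ^ 3 + 3 * (h ^ 3 * m) + 4 * h ^ 3"
      using hh by (intro add_mono mult_mono) auto
    also have "\<dots> \<le> 15 * h ^ 3 * (m + 1)" by (simp add: algebra_simps)
    finally show "h * (8 * h ^ 2 + 2 * m + 3) + (m + 1) * h \<le> 15 * h ^ 3 * (m + 1)" .
  qed simp
  finally show ?thesis .
qed

section \<open>Roots, Galois groups and norms\<close>

lemma poly_lrs_char_poly:
  "poly (lrs_char_poly k a) z = z ^ k - (\<Sum>j=1..k. of_int (a j) * z ^ (k - j))"
  by (simp add: lrs_char_poly_def poly_sum poly_monom)

lemma degree_lrs_char_poly: "Polynomial.degree (lrs_char_poly k a) \<le> k"
  unfolding lrs_char_poly_def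
  by (intro degree_diff_le degree_sum_le) (auto intro: order_trans[OF degree_monom_le])

lemma lrs_char_poly_nonzero:
  assumes "k \<ge> 1"
  shows "lrs_char_poly k a \<noteq> 0"
proof -
  have "Polynomial.coeff (lrs_char_poly k a) k = 1 - (\<Sum>j=1..k. if k - j = k then of_int (a j) else 0)"
    by (simp add: lrs_char_poly_def Polynomial.coeff_sum)
  also have "(\<Sum>j=1..k. if k - j = k then of_int (a j) else 0) = (0::complex)"
    using assms by (intro sum.neutral) auto
  finally show ?thesis by auto
qed

lemma lrs_char_poly_cong:
  "(\<And>j. j \<in> {1..k} \<Longrightarrow> a j = a' j) \<Longrightarrow> lrs_char_poly k a = lrs_char_poly k a'"
  by (simp add: lrs_char_poly_def)

lemma finite_lrs_roots: "k \<ge> 1 \<Longrightarrow> finite (lrs_roots k a)"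
  unfolding lrs_roots_def by (intro poly_roots_finite lrs_char_poly_nonzero)

lemma card_lrs_roots:
  assumes "k \<ge> 1"
  shows "card (lrs_roots k a) \<le> k"
  unfolding lrs_roots_def
  using card_poly_roots_bound[OF lrs_char_poly_nonzero[OF assms]] degree_lrs_char_poly
  by (rule order_trans)

lemma lrs_mult_le: "k \<ge> 1 \<Longrightarrow> lrs_mult k a z \<le> k"
  unfolding lrs_mult_def
  by (intro order_trans[OF order_degree degree_lrs_char_poly] lrs_char_poly_nonzero)

lemma lrs_mult_pos: "k \<ge> 1 \<Longrightarrow> z \<in> lrs_roots k a \<Longrightarrow> lrs_mult k a z \<ge> 1"
  unfolding lrs_mult_def lrs_roots_def using order_root[of "lrs_char_poly k a" z] lrs_char_poly_nonzero[of k a]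
  by (auto simp: Suc_le_eq)

text \<open>A crude Cauchy bound: for |z| > 1 the lower terms of the characteristic polynomial add
  up to at most k h |z|^(k-1), and k is itself at most h because the order is part of the
  height.\<close>

lemma norm_lrs_root_le:
  fixes h :: nat
  assumes k: "1 \<le> k" "k \<le> h" and a: "\<And>j. j \<in> {1..k} \<Longrightarrow> \<bar>a j\<bar> \<le> int h"
    and z: "z \<in> lrs_roots k a"
  shows "norm z \<le> real h ^ 2"
proof (rule ccontr)
  assume "\<not> norm z \<le> real h ^ 2"
  then have zh: "real h ^ 2 < norm z" by simp
  have "1 \<le> real h ^ 2" using k by (intro one_le_power) simp
  then have z1: "norm z > 1" using zh by linarith
  have "z ^ k = (\<Sum>j=1..k. of_int (a j) * z ^ (k - j))"
    using z by (simp add: lrs_roots_def poly_lrs_char_poly)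
  then have "norm z ^ k = norm (\<Sum>j=1..k. of_int (a j) * z ^ (k - j))"
    by (metis norm_power)
  also have "\<dots> \<le> (\<Sum>j=1..k. real h * norm z ^ (k - 1))"
  proof (rule sum_norm_le)
    fix j assume j: "j \<in> {1..k}"
    have "real_of_int \<bar>a j\<bar> \<le> real_of_int (int h)"
      using a[OF j] by (intro of_int_le_iff[THEN iffD2])
    then show "norm (of_int (a j) * z ^ (k - j)) \<le> real h * norm z ^ (k - 1)"
      using z1 j unfolding norm_mult norm_power
      by (intro mult_mono power_increasing) auto
  qed
  also have "\<dots> = (real k * real h) * norm z ^ (k - 1)" by simp
  also have "\<dots> \<le> real h ^ 2 * norm z ^ (k - 1)"
    using k by (intro mult_right_mono) (auto simp: power2_eq_square intro: mult_right_mono)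
  also have "\<dots> < norm z * norm z ^ (k - 1)"
    using zh z1 by (intro mult_strict_right_mono zero_less_power) auto
  also have "\<dots> = norm z ^ k" using k by (metis le_add_diff_inverse plus_1_eq_Suc power_Suc)
  finally show False by simp
qed

lemma galois_lrs_root:
  assumes \<tau>: "\<tau> \<in> galois_group (adjoin (lrs_roots k a))" and z: "z \<in> lrs_roots k a"
  shows "\<tau> z \<in> lrs_roots k a"
proof -
  let ?K = "adjoin (lrs_roots k a)"
  have K: "is_subfield ?K" by (rule is_subfield_adjoin)
  have zK: "z \<in> ?K" using z adjoin_superset by blast
  note mem = subfield_mult[OF K] subfield_power[OF K zK] subfield_of_int[OF K]
  have "z ^ k = (\<Sum>j=1..k. of_int (a j) * z ^ (k - j))"
    using z by (simp add: lrs_roots_def poly_lrs_char_poly)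
  then have "\<tau> (z ^ k) = (\<Sum>j=1..k. \<tau> (of_int (a j) * z ^ (k - j)))"
    by (simp add: galois_sum[OF K \<tau>] mem)
  also have "\<dots> = (\<Sum>j=1..k. of_int (a j) * \<tau> z ^ (k - j))"
    by (intro sum.cong refl)
       (simp add: galois_mult[OF K \<tau>] galois_power[OF K \<tau> zK] galois_of_int[OF K \<tau>] mem)
  finally show ?thesis
    by (simp add: galois_power[OF K \<tau> zK] lrs_roots_def poly_lrs_char_poly)
qed

text \<open>The points of \<open>adjoin S\<close> at which two automorphisms agree form a subfield
  containing S, hence all of \<open>adjoin S\<close>; outside it they agree by
  extensionality.\<close>

lemma galois_group_adjoin_eqI:
  assumes \<tau>: "\<tau> \<in> galois_group (adjoin S)" and \<tau>': "\<tau>' \<in> galois_group (adjoin S)"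
    and eq: "\<And>x. x \<in> S \<Longrightarrow> \<tau> x = \<tau>' x"
  shows "\<tau> = \<tau>'"
proof -
  note K = is_subfield_adjoin[of S]
  let ?F = "{x \<in> adjoin S. \<tau> x = \<tau>' x}"
  have "is_subfield ?F"
    unfolding is_subfield_def
    by (auto simp: galois_zero[OF K \<tau>] galois_zero[OF K \<tau>'] galois_one[OF K \<tau>] galois_one[OF K \<tau>']
          galois_add[OF K \<tau>] galois_add[OF K \<tau>'] galois_mult[OF K \<tau>] galois_mult[OF K \<tau>']
          galois_uminus[OF K \<tau>] galois_uminus[OF K \<tau>'] galois_inverse[OF K \<tau>] galois_inverse[OF K \<tau>']
        intro: subfield_zero[OF K] subfield_one[OF K] subfield_add[OF K] subfield_mult[OF K]
          subfield_uminus[OF K] subfield_inverse[OF K])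
  then have "adjoin S \<subseteq> ?F"
    using eq adjoin_superset by (intro adjoin_least) auto
  then show ?thesis
    using \<tau> \<tau>' by (intro extensionalityI[of \<tau> "adjoin S"]) (auto simp: galois_group_def)
qed

text \<open>An automorphism is determined by its restriction to the roots, which is a self-map of a
  set with at most k elements.\<close>

lemma card_galois_group_le:
  assumes "k \<ge> 1"
  shows "card (galois_group (adjoin (lrs_roots k a))) \<le> k ^ k"
proof -
  let ?R = "lrs_roots k a" and ?G = "galois_group (adjoin (lrs_roots k a))"
  have R: "finite ?R" "card ?R \<le> k" using assms by (auto intro: finite_lrs_roots card_lrs_roots)
  have "card ?G \<le> card (?R \<rightarrow>\<^sub>E ?R)"
  proof (rule card_inj_on_le[of "\<lambda>\<tau>. restrict \<tau> ?R"])
    show "inj_on (\<lambda>\<tau>. restrict \<tau> ?R) ?G"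
    proof (rule inj_onI)
      fix \<tau> \<tau>' assume G: "\<tau> \<in> ?G" "\<tau>' \<in> ?G" and eq: "restrict \<tau> ?R = restrict \<tau>' ?R"
      show "\<tau> = \<tau>'"
        using G by (rule galois_group_adjoin_eqI) (metis eq restrict_apply')
    qed
    show "(\<lambda>\<tau>. restrict \<tau> ?R) ` ?G \<subseteq> ?R \<rightarrow>\<^sub>E ?R"
      by (auto intro: galois_lrs_root)
  qed (use R in \<open>auto intro: finite_PiE\<close>)
  also have "\<dots> = card ?R ^ card ?R" using R by (simp add: card_PiE)
  also have "\<dots> \<le> k ^ card ?R" using R by (intro power_mono) auto
  also have "\<dots> \<le> k ^ k" using R assms by (intro power_increasing) auto
  finally show ?thesis .
qed

text \<open>The bound is a power of 2 because \<open>card_prime_divisors_le\<close> turns its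
  exponent into a bound for the number of prime divisors. The factor h ^ h in the exponent accounts
  for the number of conjugates.\<close>

lemma field_norm_cramer_v:
  fixes h :: nat
  assumes k: "1 \<le> k" "k \<le> h" and h: "h \<ge> 2"
    and a: "\<And>j. j \<in> {1..k} \<Longrightarrow> \<bar>a j\<bar> \<le> int h"
    and u: "\<And>i. i < k \<Longrightarrow> \<bar>u i\<bar> \<le> int h"
    and ix: "\<And>n. n < k \<Longrightarrow> snd (ix n) \<le> k"
    and \<alpha>: "\<And>n. n < k \<Longrightarrow> \<alpha> (fst (ix n)) \<in> lrs_roots k a"
    and \<beta>: "\<And>n. n < k \<Longrightarrow> \<beta> (fst (ix n)) \<in> lrs_roots k a"
    and nz: "cramer_v k ix u m \<alpha> \<beta> \<noteq> 0"
    and N: "field_norm (adjoin (lrs_roots k a)) (cramer_v k ix u m \<alpha> \<beta>) = of_int N"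
  shows "N \<noteq> 0" and "\<bar>N\<bar> \<le> 2 ^ (15 * h ^ 3 * (m + 1) * h ^ h)"
proof -
  let ?K = "adjoin (lrs_roots k a)" and ?v = "cramer_v k ix u m \<alpha> \<beta>"
  have K: "is_subfield ?K" by (rule is_subfield_adjoin)
  have \<alpha>K: "\<alpha> (fst (ix n)) \<in> ?K" if "n < k" for n using \<alpha>[OF that] adjoin_superset by blast
  have \<beta>K: "\<beta> (fst (ix n)) \<in> ?K" if "n < k" for n using \<beta>[OF that] adjoin_superset by blast
  have v: "?v \<in> ?K" using K \<alpha>K \<beta>K by (rule cramer_v_in)
  \<comment> \<open>A product over an infinite set is 1 by convention; over a finite group no factor
    vanishes, since automorphisms are injective.\<close>
  have "field_norm ?K ?v \<noteq> 0"
    unfolding field_norm_def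
    by (cases "finite (galois_group ?K)") (auto dest: galois_nonzero[OF K _ v nz])
  then show "N \<noteq> 0" using N by auto
  have b: "norm (\<tau> ?v) \<le> 2 ^ (15 * h ^ 3 * (m + 1))" if \<tau>: "\<tau> \<in> galois_group ?K" for \<tau>
  proof -
    have "\<tau> ?v = cramer_v k ix u m (\<tau> \<circ> \<alpha>) (\<tau> \<circ> \<beta>)"
      using K \<alpha>K \<beta>K \<tau> by (rule galois_cramer_v)
    moreover have "norm (\<tau> z) \<le> real h ^ 2" if "z \<in> lrs_roots k a" for z
      using k a galois_lrs_root[OF \<tau> that] by (rule norm_lrs_root_le)
    then have "norm (cramer_v k ix u m (\<tau> \<circ> \<alpha>) (\<tau> \<circ> \<beta>)) \<le> 2 ^ (15 * h ^ 3 * (m + 1))"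
      using \<alpha> \<beta> by (intro norm_cramer_v_le[OF k(2) h ix u]) auto
    ultimately show ?thesis by simp
  qed
  have "norm (field_norm ?K ?v) = (\<Prod>\<tau>\<in>galois_group ?K. norm (\<tau> ?v))"
    by (simp add: field_norm_def prod_norm)
  also have "\<dots> \<le> (\<Prod>\<tau>\<in>galois_group ?K. 2 ^ (15 * h ^ 3 * (m + 1)))"
    using b by (intro prod_mono) auto
  also have "\<dots> = 2 ^ (15 * h ^ 3 * (m + 1) * card (galois_group ?K))"
    by (simp only: prod_constant power_mult)
  also have "\<dots> \<le> 2 ^ (15 * h ^ 3 * (m + 1) * h ^ h)"
  proof (intro power_increasing mult_left_mono)
    have "card (galois_group ?K) \<le> k ^ k" by (rule card_galois_group_le[OF k(1)])
    also have "\<dots> \<le> h ^ k" using k by (intro power_mono) auto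
    also have "\<dots> \<le> h ^ h" using k by (intro power_increasing) auto
    finally show "card (galois_group ?K) \<le> h ^ h" .
  qed auto
  finally have "real_of_int \<bar>N\<bar> \<le> real_of_int (2 ^ (15 * h ^ 3 * (m + 1) * h ^ h))"
    unfolding N by simp
  then show "\<bar>N\<bar> \<le> 2 ^ (15 * h ^ 3 * (m + 1) * h ^ h)" by linarith
qed

section \<open>Recovering v from Cramer's rule\<close>

text \<open>The columns of \<open>lrs_Delta\<close> in their original order, each recorded as (root
  index, exponent), so that a single index n < k addresses the nested blocks.\<close>

definition block_index :: "nat \<Rightarrow> (nat \<Rightarrow> nat) \<Rightarrow> (nat \<times> nat) list" where
  "block_index s \<mu> = concat (map (\<lambda>l. map (Pair l) [0..<\<mu> l]) [1..<Suc s])"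

lemma set_block_index: "set (block_index s \<mu>) = {(l, j). l \<in> {1..s} \<and> j < \<mu> l}"
  by (auto simp: block_index_def)

lemma block_index_cong: "(\<And>l. l \<in> {1..s} \<Longrightarrow> \<mu> l = \<mu>' l) \<Longrightarrow> block_index s \<mu> = block_index s \<mu>'"
  unfolding block_index_def by (intro arg_cong[where f=concat] map_cong) auto

text \<open>Cramer's rule produces one sum over the k columns, the exponential polynomial is a
  double sum over roots and coefficients; this passes between the two.\<close>

lemma sum_block_index:
  fixes f :: "nat \<Rightarrow> nat \<Rightarrow> 'a :: comm_monoid_add"
  assumes "length (block_index s \<mu>) = k"
  shows "(\<Sum>n<k. f (fst (block_index s \<mu> ! n)) (snd (block_index s \<mu> ! n))) = (\<Sum>l=1..s. \<Sum>j<\<mu> l. f l j)"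
proof -
  have "(\<Sum>n<k. f (fst (block_index s \<mu> ! n)) (snd (block_index s \<mu> ! n))) =
      sum_list (map (\<lambda>p. f (fst p) (snd p)) (block_index s \<mu>))"
    using assms by (simp add: sum_list_sum_nth atLeast0LessThan)
  also have "\<dots> = sum_list (map (\<lambda>l. sum_list (map (f l) [0..<\<mu> l])) [1..<Suc s])"
  proof -
    have "sum_list (map (\<lambda>p. f (fst p) (snd p)) (concat (map (\<lambda>l. map (Pair l) [0..<\<mu> l]) ls))) =
        sum_list (map (\<lambda>l. sum_list (map (f l) [0..<\<mu> l])) ls)" for ls
      by (induction ls) (simp_all add: comp_def)
    then show ?thesis by (simp only: block_index_def)
  qed
  also have "\<dots> = (\<Sum>l=1..s. \<Sum>j<\<mu> l. f l j)"
    by (simp add: sum_list_distinct_conv_sum_set atLeast0LessThan atLeastLessThanSuc_atLeastAtMost del: upt_Suc)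
  finally show ?thesis .
qed

lemma poly_eq_sum_coeff:
  fixes p :: "'a :: comm_ring_1 poly"
  assumes "Polynomial.degree p < d"
  shows "poly p x = (\<Sum>j<d. Polynomial.coeff p j * x ^ j)"
  unfolding poly_altdef
  using assms by (intro sum.mono_neutral_left) (auto intro: le_degree)

text \<open>If v is nonzero then so is Delta; as \<open>det\<close> is 0 on non-square matrices, this already forces the
  multiplicities to sum to k.\<close>

lemma lrs_v_eq_cramer_v:
  fixes k a s \<alpha>
  defines "ixs \<equiv> block_index s (\<lambda>l. lrs_mult k a (\<alpha> l))"
  assumes Q: "exp_poly_form k a u s \<alpha> Q"
    and mult: "\<And>l. l \<in> {1..s} \<Longrightarrow> lrs_mult k a (\<alpha> l) \<ge> 1"
    and nz: "lrs_v k a s \<alpha> Q m \<sigma> \<noteq> 0"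
  shows "length ixs = k" and "lrs_v k a s \<alpha> Q m \<sigma> = cramer_v k ((!) ixs) u m \<alpha> (\<alpha> \<circ> \<sigma>)"
proof -
  define \<mu> where "\<mu> = (\<lambda>l. lrs_mult k a (\<alpha> l))"
  define D where "D = lrs_Delta k a s \<alpha>"
  have ixs: "ixs = block_index s \<mu>" by (simp add: ixs_def \<mu>_def)
  have "D \<noteq> 0" using nz by (auto simp: lrs_v_def D_def)
  let ?cols = "map (\<lambda>(l, j). vec k (\<lambda>i. of_nat i ^ j * \<alpha> l ^ i)) ixs"
  have D: "D = det (mat_of_cols k ?cols)"
    unfolding D_def lrs_Delta_def ixs_def block_index_def map_concat map_map comp_def prod.case ..
  then show len: "length ixs = k"
    using \<open>D \<noteq> 0\<close> by (auto simp: det_def split: if_splits)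
  define M where "M = confluent k ((!) ixs) \<alpha>"
  have "mat_of_cols k ?cols = M"
    unfolding M_def using len
    by (intro eq_matI) (auto simp: mat_of_cols_def confluent_def case_prod_unfold)
  then have DM: "D = det M" using D by simp
  have M: "M \<in> carrier_mat k k" by (simp add: M_def)
  \<comment> \<open>The coefficients of all Q l, in column order, solve the k linear equations that
    express u 0, ..., u (k - 1) through the exponential polynomial.\<close>
  define x where "x = vec k (\<lambda>n. Polynomial.coeff (Q (fst (ixs ! n))) (snd (ixs ! n)))"
  have x: "x \<in> carrier_vec k" by (simp add: x_def)
  \<comment> \<open>The bound in \<open>exp_poly_form\<close> uses truncated subtraction; it becomes
    strict because every multiplicity is at least 1.\<close>
  have deg: "Polynomial.degree (Q l) < \<mu> l" if "l \<in> {1..s}" for l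
    using Q mult[OF that] that unfolding exp_poly_form_def \<mu>_def by fastforce
  have Mx: "M *\<^sub>v x = vec k (\<lambda>i. of_int (u i))"
  proof (rule eq_vecI)
    fix i assume "i < dim_vec (vec k (\<lambda>i. of_int (u i) :: complex))"
    then have i: "i < k" by simp
    have "(M *\<^sub>v x) $ i = (\<Sum>n<k. of_nat i ^ snd (ixs ! n) * \<alpha> (fst (ixs ! n)) ^ i *
        Polynomial.coeff (Q (fst (ixs ! n))) (snd (ixs ! n)))"
      using i M by (simp add: scalar_prod_def x_def M_def confluent_def atLeast0LessThan)
    also have "\<dots> = (\<Sum>l=1..s. \<Sum>j<\<mu> l. of_nat i ^ j * \<alpha> l ^ i * Polynomial.coeff (Q l) j)"
      using sum_block_index[OF len[unfolded ixs]] unfolding ixs .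
    also have "\<dots> = (\<Sum>l=1..s. poly (Q l) (of_nat i) * \<alpha> l ^ i)"
      by (intro sum.cong refl) (simp add: poly_eq_sum_coeff[OF deg] sum_distrib_right sum_distrib_left mult_ac)
    also have "\<dots> = of_int (u i)"
      using Q by (simp add: exp_poly_form_def)
    finally show "(M *\<^sub>v x) $ i = vec k (\<lambda>i. of_int (u i)) $ i" using i by simp
  qed (use M in simp)
  have cr: "det (replace_col M (vec k (\<lambda>i. of_int (u i))) n) = x $ n * D" if "n < k" for n
    using cramer_lemma_mat[OF M x that] by (simp add: Mx DM)
  \<comment> \<open>Of the two factors D, one is the leading determinant and the other comes from
    the replaced column; together they give the Delta^2 in \<open>lrs_v\<close>.\<close>
  have "cramer_v k ((!) ixs) u m \<alpha> (\<alpha> \<circ> \<sigma>) = D * (\<Sum>n<k. (x $ n * D) *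
      (of_nat m ^ snd (ixs ! n) * \<alpha> (\<sigma> (fst (ixs ! n))) * \<alpha> (fst (ixs ! n)) ^ m))"
    unfolding cramer_v_def M_def[symmetric] DM[symmetric] by (simp add: cr)
  also have "\<dots> = (\<Sum>n<k. D\<^sup>2 * (Polynomial.coeff (Q (fst (ixs ! n))) (snd (ixs ! n)) *
      of_nat m ^ snd (ixs ! n)) * \<alpha> (\<sigma> (fst (ixs ! n))) * \<alpha> (fst (ixs ! n)) ^ m)"
    unfolding sum_distrib_left by (intro sum.cong refl) (simp add: x_def power2_eq_square mult_ac)
  also have "\<dots> = (\<Sum>l=1..s. \<Sum>j<\<mu> l. D\<^sup>2 * (Polynomial.coeff (Q l) j * of_nat m ^ j) *
      \<alpha> (\<sigma> l) * \<alpha> l ^ m)"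
    using sum_block_index[OF len[unfolded ixs]] unfolding ixs .
  also have "\<dots> = lrs_v k a s \<alpha> Q m \<sigma>"
    unfolding lrs_v_def Let_def D_def[symmetric]
    by (intro sum.cong refl)
       (simp add: poly_eq_sum_coeff[OF deg] sum_distrib_right sum_distrib_left mult_ac)
  finally show "lrs_v k a s \<alpha> Q m \<sigma> = cramer_v k ((!) ixs) u m \<alpha> (\<alpha> \<circ> \<sigma>)" ..
qed

section \<open>Counting bad primes\<close>

text \<open>Neither Q nor a permutation occurs any more, and s has become the number of roots, so
  all parameters can range over finite sets. The set is empty unless the list of columns has length
  k, which keeps \<open>(!) ixs\<close> within bounds.\<close>

definition norm_prime_divisors ::
  "nat \<Rightarrow> (nat \<Rightarrow> int) \<Rightarrow> (nat \<Rightarrow> int) \<Rightarrow> nat \<Rightarrow> (nat \<Rightarrow> complex) \<Rightarrow> (nat \<Rightarrow> complex) \<Rightarrow> nat set"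
  where
  "norm_prime_divisors k a u m \<alpha> \<beta> =
     (let ixs = block_index (card (lrs_roots k a)) (\<lambda>l. lrs_mult k a (\<alpha> l));
          v = cramer_v k ((!) ixs) u m \<alpha> \<beta>
      in {p. prime p \<and> length ixs = k \<and> v \<noteq> 0 \<and>
             (\<exists>N. field_norm (adjoin (lrs_roots k a)) v = of_int N \<and> int p dvd N)})"

text \<open>The parameters determine v, and v determines the integer N, so all members are prime
  divisors of one nonzero number.\<close>

lemma
  fixes h :: nat
  assumes k: "1 \<le> k" "k \<le> h" and h: "h \<ge> 2"
    and a: "\<And>j. j \<in> {1..k} \<Longrightarrow> \<bar>a j\<bar> \<le> int h"
    and u: "\<And>i. i < k \<Longrightarrow> \<bar>u i\<bar> \<le> int h"
    and \<alpha>: "\<And>l. l \<in> {1..card (lrs_roots k a)} \<Longrightarrow> \<alpha> l \<in> lrs_roots k a"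
    and \<beta>: "\<And>l. l \<in> {1..card (lrs_roots k a)} \<Longrightarrow> \<beta> l \<in> lrs_roots k a"
  shows finite_norm_prime_divisors: "finite (norm_prime_divisors k a u m \<alpha> \<beta>)"
    and card_norm_prime_divisors: "card (norm_prime_divisors k a u m \<alpha> \<beta>) \<le> 15 * h ^ 3 * (m + 1) * h ^ h"
proof -
  define ixs where "ixs = block_index (card (lrs_roots k a)) (\<lambda>l. lrs_mult k a (\<alpha> l))"
  let ?v = "cramer_v k ((!) ixs) u m \<alpha> \<beta>"
  let ?D = "norm_prime_divisors k a u m \<alpha> \<beta>"
  have D: "?D = {p. prime p \<and> length ixs = k \<and> ?v \<noteq> 0 \<and>
             (\<exists>N. field_norm (adjoin (lrs_roots k a)) ?v = of_int N \<and> int p dvd N)}"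
    unfolding norm_prime_divisors_def ixs_def Let_def ..
  have "finite ?D \<and> card ?D \<le> 15 * h ^ 3 * (m + 1) * h ^ h"
  proof (cases "?D = {}")
    case False
    then obtain N where len: "length ixs = k" and nz: "?v \<noteq> 0"
      and N: "field_norm (adjoin (lrs_roots k a)) ?v = of_int N"
      unfolding D by auto
    have mem: "ixs ! n \<in> {(l, j). l \<in> {1..card (lrs_roots k a)} \<and> j < lrs_mult k a (\<alpha> l)}" if "n < k" for n
      using nth_mem[of n ixs] that len unfolding ixs_def set_block_index by simp
    have snd: "snd (ixs ! n) \<le> k" if "n < k" for n
      using mem[OF that] lrs_mult_le[OF k(1), of a "\<alpha> (fst (ixs ! n))"] by (auto simp: case_prod_unfold)
    have fst: "fst (ixs ! n) \<in> {1..card (lrs_roots k a)}" if "n < k" for n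
      using mem[OF that] by (auto simp: case_prod_unfold)
    have N0: "N \<noteq> 0" and Nle: "\<bar>N\<bar> \<le> 2 ^ (15 * h ^ 3 * (m + 1) * h ^ h)"
      using field_norm_cramer_v[OF k h a u snd \<alpha>[OF fst] \<beta>[OF fst] nz N] by auto
    have "?D \<subseteq> {p. prime p \<and> p dvd nat \<bar>N\<bar>}"
    proof
      fix p assume "p \<in> ?D"
      then have "prime p" "int p dvd N" unfolding D using N by auto
      then show "p \<in> {p. prime p \<and> p dvd nat \<bar>N\<bar>}"
        using int_dvd_int_iff[of p "nat \<bar>N\<bar>"] by simp
    qed
    moreover have "finite {p. prime p \<and> p dvd nat \<bar>N\<bar>}"
      using N0 by (intro finite_subset[OF _ finite_divisors_nat[of "nat \<bar>N\<bar>"]]) auto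
    ultimately have fin: "finite ?D" and "card ?D \<le> card {p. prime p \<and> p dvd nat \<bar>N\<bar>}"
      by (auto intro: card_mono finite_subset)
    note this(2)
    also have "\<dots> \<le> 15 * h ^ 3 * (m + 1) * h ^ h"
    proof (rule card_prime_divisors_le)
      have "int (nat \<bar>N\<bar>) \<le> int (2 ^ (15 * h ^ 3 * (m + 1) * h ^ h))" using Nle by simp
      then show "nat \<bar>N\<bar> \<le> 2 ^ (15 * h ^ 3 * (m + 1) * h ^ h)" by (simp only: of_nat_le_iff)
    qed (use N0 in simp)
    finally show ?thesis using fin by simp
  qed simp
  then show "finite ?D" "card ?D \<le> 15 * h ^ 3 * (m + 1) * h ^ h" by simp_all
qed

lemma card_UN_le_mult:
  assumes "finite I" "card I \<le> n" "\<And>i. i \<in> I \<Longrightarrow> card (A i) \<le> b"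
  shows "card (\<Union>i\<in>I. A i) \<le> n * b"
proof -
  have "card (\<Union>i\<in>I. A i) \<le> (\<Sum>i\<in>I. card (A i))" using assms(1) by (rule card_UN_le)
  also have "\<dots> \<le> (\<Sum>i\<in>I. b)" using assms(3) by (rule sum_mono)
  also have "\<dots> \<le> n * b" using assms(2) by (simp add: mult_right_mono)
  finally show ?thesis .
qed

text \<open>The function \<open>\<beta>\<close> stands for \<open>\<alpha> \<circ> \<sigma>\<close>; letting it range over all maps into the roots avoids
  counting permutations.\<close>

definition norm_primes_upto :: "nat \<Rightarrow> nat \<Rightarrow> nat set" where
  "norm_primes_upto h M = (\<Union>k\<in>{1..h}.
     \<Union>a\<in>{1..k} \<rightarrow>\<^sub>E {-int h..int h}. \<Union>u\<in>{..<k} \<rightarrow>\<^sub>E {-int h..int h}.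
     \<Union>\<alpha>\<in>{1..card (lrs_roots k a)} \<rightarrow>\<^sub>E lrs_roots k a. \<Union>\<beta>\<in>{1..card (lrs_roots k a)} \<rightarrow>\<^sub>E lrs_roots k a.
     \<Union>m\<in>{..M}. norm_prime_divisors k a u m \<alpha> \<beta>)"

text \<open>From left to right the factors account for k, a, u, \<alpha>, \<beta>, m and the prime
  divisors belonging to one choice of these.\<close>

lemma
  fixes h :: nat
  assumes h: "h \<ge> 2"
  shows finite_norm_primes_upto: "finite (norm_primes_upto h M)"
    and card_norm_primes_upto: "card (norm_primes_upto h M) \<le>
     h * ((2 * h + 1) ^ h * ((2 * h + 1) ^ h * (h ^ h * (h ^ h *
       ((M + 1) * (15 * h ^ 3 * (M + 1) * h ^ h))))))"
proof -
  let ?A = "\<lambda>k. {1..k} \<rightarrow>\<^sub>E {-int h..int h}" and ?U = "\<lambda>k. {..<k} \<rightarrow>\<^sub>E {-int h..int h}"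
    and ?R = lrs_roots
  let ?S = "\<lambda>k a. {1..card (?R k a)} \<rightarrow>\<^sub>E ?R k a"
  have int: "card (I \<rightarrow>\<^sub>E {-int h..int h}) \<le> (2 * h + 1) ^ h"
    if "finite I" "card I \<le> h" for I :: "nat set"
  proof -
    have "card (I \<rightarrow>\<^sub>E {-int h..int h}) = (2 * h + 1) ^ card I"
      using that by (simp add: card_PiE nat_add_distrib nat_mult_distrib)
    also have "\<dots> \<le> (2 * h + 1) ^ h" using that by (intro power_increasing) auto
    finally show ?thesis .
  qed
  have A: "finite (?A k)" "card (?A k) \<le> (2 * h + 1) ^ h"
    and U: "finite (?U k)" "card (?U k) \<le> (2 * h + 1) ^ h"
    if "k \<in> {1..h}" for k using that by (auto intro!: finite_PiE int[simplified])
  have S: "finite (?S k a)" "card (?S k a) \<le> h ^ h" if "k \<in> {1..h}" for k a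
  proof -
    have R: "finite (?R k a)" "card (?R k a) \<le> h"
      using that card_lrs_roots[of k a] by (auto intro: finite_lrs_roots)
    then show "finite (?S k a)" by (intro finite_PiE) auto
    have "card (?S k a) = card (?R k a) ^ card (?R k a)" by (simp add: card_PiE)
    also have "\<dots> \<le> h ^ card (?R k a)" using R by (intro power_mono) auto
    also have "\<dots> \<le> h ^ h" using R h by (intro power_increasing) auto
    finally show "card (?S k a) \<le> h ^ h" .
  qed
  have D: "finite (norm_prime_divisors k a u m \<alpha> \<beta>)"
    "card (norm_prime_divisors k a u m \<alpha> \<beta>) \<le> 15 * h ^ 3 * (M + 1) * h ^ h"
    if "k \<in> {1..h}" "a \<in> ?A k" "u \<in> ?U k" "\<alpha> \<in> ?S k a" "\<beta> \<in> ?S k a" "m \<in> {..M}"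
    for k a u \<alpha> \<beta> m
  proof -
    have k: "1 \<le> k" "k \<le> h" using that by auto
    have a: "\<bar>a j\<bar> \<le> int h" if "j \<in> {1..k}" for j
      using PiE_mem[OF \<open>a \<in> ?A k\<close> that] by auto
    have u: "\<bar>u j\<bar> \<le> int h" if "j < k" for j
      using PiE_mem[OF \<open>u \<in> ?U k\<close>, of j] that by auto
    note \<alpha> = PiE_mem[OF \<open>\<alpha> \<in> ?S k a\<close>] and \<beta> = PiE_mem[OF \<open>\<beta> \<in> ?S k a\<close>]
    show "finite (norm_prime_divisors k a u m \<alpha> \<beta>)"
      using k h a u \<alpha> \<beta> by (rule finite_norm_prime_divisors)
    have "card (norm_prime_divisors k a u m \<alpha> \<beta>) \<le> 15 * h ^ 3 * (m + 1) * h ^ h"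
      using k h a u \<alpha> \<beta> by (rule card_norm_prime_divisors)
    also have "\<dots> \<le> 15 * h ^ 3 * (M + 1) * h ^ h"
      using that by (intro mult_mono) auto
    finally show "card (norm_prime_divisors k a u m \<alpha> \<beta>) \<le> 15 * h ^ 3 * (M + 1) * h ^ h" .
  qed
  show "finite (norm_primes_upto h M)"
    unfolding norm_primes_upto_def
    by (rule finite_UN_I, simp, rule finite_UN_I, rule A, assumption, rule finite_UN_I, rule U, assumption,
        rule finite_UN_I, rule S, assumption, rule finite_UN_I, rule S, assumption,
        rule finite_UN_I, simp, rule D, assumption+)
  show "card (norm_primes_upto h M) \<le>
     h * ((2 * h + 1) ^ h * ((2 * h + 1) ^ h * (h ^ h * (h ^ h *
       ((M + 1) * (15 * h ^ 3 * (M + 1) * h ^ h))))))"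
    unfolding norm_primes_upto_def
    by (rule card_UN_le_mult, simp, simp, rule card_UN_le_mult, rule A, assumption, rule A, assumption,
        rule card_UN_le_mult, rule U, assumption, rule U, assumption,
        rule card_UN_le_mult, rule S, assumption, rule S, assumption,
        rule card_UN_le_mult, rule S, assumption, rule S, assumption,
        rule card_UN_le_mult, simp, simp, rule D, assumption+)
qed

lemma lrs_height_bounds:
  assumes "lrs_height k a u \<le> int h"
  shows "k \<le> h" and "j \<in> {1..k} \<Longrightarrow> \<bar>a j\<bar> \<le> int h" and "i < k \<Longrightarrow> \<bar>u i\<bar> \<le> int h"
proof -
  let ?S = "{int k} \<union> (\<lambda>j. \<bar>a j\<bar>) ` {1..k} \<union> (\<lambda>j. \<bar>u j\<bar>) ` {..<k}"
  have *: "x \<le> int h" if "x \<in> ?S" for x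
    proof -
    have "x \<le> Max ?S" using that by (intro Max_ge) auto
    also have "\<dots> \<le> int h" using assms by (simp only: lrs_height_def)
    finally show ?thesis .
  qed
  show "k \<le> h" using *[of "int k"] by simp
  show "j \<in> {1..k} \<Longrightarrow> \<bar>a j\<bar> \<le> int h" using *[of "\<bar>a j\<bar>"] by blast
  show "i < k \<Longrightarrow> \<bar>u i\<bar> \<le> int h" using *[of "\<bar>u i\<bar>"] by blast
qed

text \<open>Restricting a, u, \<alpha> and \<alpha> \<circ> \<sigma> to the arguments that matter
  puts them into the finite function spaces of \<open>norm_primes_upto\<close> and changes neither
  the roots, nor the multiplicities, nor v.\<close>

lemma bad_prime_in_norm_primes_upto:
  fixes h M :: nat
  assumes lrs: "lrs k a u" and H: "lrs_height k a u \<le> int h" and m: "m \<le> M"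
    and enum: "root_enumeration k a s \<alpha>" and Q: "exp_poly_form k a u s \<alpha> Q"
    and \<sigma>: "\<sigma> permutes {1..s}" and nz: "lrs_v k a s \<alpha> Q m \<sigma> \<noteq> 0"
    and N: "field_norm (adjoin (lrs_roots k a)) (lrs_v k a s \<alpha> Q m \<sigma>) = of_int N"
    and p: "prime p" "int p dvd N"
  shows "p \<in> norm_primes_upto h M"
proof -
  have k: "1 \<le> k" using lrs by (simp add: lrs_def)
  note hb = lrs_height_bounds[OF H]
  have s: "card (lrs_roots k a) = s"
    using bij_betw_same_card[OF enum[unfolded root_enumeration_def]] by simp
  have root: "\<alpha> l \<in> lrs_roots k a" if "l \<in> {1..s}" for l
    using enum that by (auto simp: root_enumeration_def bij_betw_def)
  define ixs where "ixs = block_index s (\<lambda>l. lrs_mult k a (\<alpha> l))"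
  have len: "length ixs = k" and v: "lrs_v k a s \<alpha> Q m \<sigma> = cramer_v k ((!) ixs) u m \<alpha> (\<alpha> \<circ> \<sigma>)"
    using lrs_v_eq_cramer_v[OF Q lrs_mult_pos[OF k root] nz] by (auto simp: ixs_def)
  define a' where "a' = restrict a {1..k}"
  define u' where "u' = restrict u {..<k}"
  define \<alpha>' where "\<alpha>' = restrict \<alpha> {1..s}"
  define \<beta>' where "\<beta>' = restrict (\<alpha> \<circ> \<sigma>) {1..s}"
  have "lrs_char_poly k a' = lrs_char_poly k a"
    by (rule lrs_char_poly_cong) (simp add: a'_def)
  then have a': "lrs_roots k a' = lrs_roots k a" "lrs_mult k a' = lrs_mult k a"
    by (auto simp: lrs_roots_def lrs_mult_def fun_eq_iff)
  have ixs': "block_index s (\<lambda>l. lrs_mult k a' (\<alpha>' l)) = ixs"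
    unfolding ixs_def a' by (rule block_index_cong) (simp add: \<alpha>'_def)
  have fst: "fst (ixs ! n) \<in> {1..s}" if "n < k" for n
    using nth_mem[of n ixs] that len unfolding ixs_def set_block_index by (auto simp: case_prod_unfold)
  have v': "cramer_v k ((!) ixs) u' m \<alpha>' \<beta>' = lrs_v k a s \<alpha> Q m \<sigma>"
    unfolding v using fst by (intro cramer_v_cong) (auto simp: u'_def \<alpha>'_def \<beta>'_def)
  have pp: "p \<in> norm_prime_divisors k a' u' m \<alpha>' \<beta>'"
    unfolding norm_prime_divisors_def Let_def a'(1) s ixs' v' using len nz N p by auto
  have kk: "k \<in> {1..h}" using k hb(1) by simp
  have aa: "a' \<in> {1..k} \<rightarrow>\<^sub>E {-int h..int h}"
    unfolding a'_def restrict_PiE_iff using hb(2) by (auto simp: abs_le_iff minus_le_iff)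
  have uu: "u' \<in> {..<k} \<rightarrow>\<^sub>E {-int h..int h}"
    unfolding u'_def restrict_PiE_iff using hb(3) by (auto simp: abs_le_iff minus_le_iff)
  have \<alpha>\<alpha>: "\<alpha>' \<in> {1..card (lrs_roots k a')} \<rightarrow>\<^sub>E lrs_roots k a'"
    unfolding \<alpha>'_def restrict_PiE_iff a' s using root by blast
  have \<beta>\<beta>: "\<beta>' \<in> {1..card (lrs_roots k a')} \<rightarrow>\<^sub>E lrs_roots k a'"
    unfolding \<beta>'_def restrict_PiE_iff a' s using root permutes_in_image[OF \<sigma>] by simp
  have mm: "m \<in> {..M}" using m by simp
  show ?thesis
    unfolding norm_primes_upto_def
    by (rule UN_I[OF kk], rule UN_I[OF aa], rule UN_I[OF uu], rule UN_I[OF \<alpha>\<alpha>],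
        rule UN_I[OF \<beta>\<beta>], rule UN_I[OF mm], rule pp)
qed

section \<open>Numerical estimates for one level\<close>

text \<open>With 2 h + 1 and 15 replaced by h ^ 2 the powers of h have total exponent 7 h + 6, which
  is rounded up to 10 h to fit the constant in \<open>small_at\<close>.\<close>

lemma level_count_bound:
  fixes h M :: nat
  assumes "h \<ge> 12"
  shows "real (h * ((2 * h + 1) ^ h * ((2 * h + 1) ^ h * (h ^ h * (h ^ h *
       ((M + 1) * (15 * h ^ 3 * (M + 1) * h ^ h))))))) \<le> real h ^ (10 * h) * (real M + 1) ^ 2"
proof -
  have "12 * h \<le> h * h" using assms by (intro mult_right_mono) auto
  then have hh: "2 * h + 1 \<le> h ^ 2" "15 \<le> h ^ 2"
    using assms unfolding power2_eq_square by linarith+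
  have b: "(2 * h + 1) ^ h \<le> h ^ (2 * h)"
    unfolding power_mult using hh by (intro power_mono) auto
  have "h * ((2 * h + 1) ^ h * ((2 * h + 1) ^ h * (h ^ h * (h ^ h *
       ((M + 1) * (15 * h ^ 3 * (M + 1) * h ^ h)))))) \<le>
     h * (h ^ (2 * h) * (h ^ (2 * h) * (h ^ h * (h ^ h * ((M + 1) * (h ^ 2 * h ^ 3 * (M + 1) * h ^ h))))))"
    by (intro mult_mono order_refl b hh) auto
  also have "\<dots> = h ^ (1 + 2 * h + 2 * h + h + h + 2 + 3 + h) * (M + 1) ^ 2"
    by (simp only: power_add power_one_right power2_eq_square[of "M + 1"] mult_ac)
  also have "\<dots> \<le> h ^ (10 * h) * (M + 1) ^ 2"
    using assms by (intro mult_right_mono power_increasing) auto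
  finally have "real (h * ((2 * h + 1) ^ h * ((2 * h + 1) ^ h * (h ^ h * (h ^ h *
       ((M + 1) * (15 * h ^ 3 * (M + 1) * h ^ h))))))) \<le> real (h ^ (10 * h) * (M + 1) ^ 2)"
    by (rule of_nat_mono)
  then show ?thesis by (simp only: of_nat_mult of_nat_power of_nat_add of_nat_1)
qed

lemma less_lnI:
  fixes a x :: real
  assumes "exp a < x"
  shows "a < ln x"
  using ln_less_cancel_iff[of "exp a" x] less_trans[OF exp_gt_zero assms] assms by simp

text \<open>The bound on h gives h <= ln (ln X), hence ln h <= ln (ln (ln X)), which cancels the
  denominator: h ln h <= ln (ln X) / 10. The threshold for X makes the triple logarithm exceed
  1.\<close>

lemma power_self_le_ln:
  fixes h :: nat and X :: real
  assumes X: "X > exp (exp (exp 1))" and h: "h \<ge> 1" "real h \<le> ln (ln X) / (10 * ln (ln (ln X)))"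
  shows "real h ^ (10 * h) \<le> ln X"
proof -
  have l1: "ln X > exp (exp 1)" using X by (rule less_lnI)
  then have "ln X > 0" using less_trans[OF exp_gt_zero] by blast
  have l2: "ln (ln X) > exp 1" using l1 by (rule less_lnI)
  then have "ln (ln X) > 0" using less_trans[OF exp_gt_zero] by blast
  have l3: "ln (ln (ln X)) > 1" using l2 by (rule less_lnI)
  have "ln (ln X) \<le> ln (ln X) * (10 * ln (ln (ln X)))"
    using \<open>ln (ln X) > 0\<close> l3 by simp
  then have "ln (ln X) / (10 * ln (ln (ln X))) \<le> ln (ln X)"
    using l3 by (simp add: divide_le_eq)
  then have "ln (real h) \<le> ln (ln (ln X))" using h by simp
  then have "real h * ln (real h) \<le> ln (ln X) / (10 * ln (ln (ln X))) * ln (ln (ln X))"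
    using h by (intro mult_mono) auto
  also have "\<dots> = ln (ln X) / 10" using l3 by simp
  finally have "real (10 * h) * ln (real h) \<le> ln (ln X)" by simp
  then have "ln (real h ^ (10 * h)) \<le> ln (ln X)"
    using h by (simp add: ln_realpow)
  then show ?thesis
    using h \<open>ln X > 0\<close> by (subst (asm) ln_le_cancel_iff) auto
qed

text \<open>The witness X in \<open>bad_prime\<close> is made a parameter here, so that each level
  can be counted separately.\<close>

definition bad_primes_level :: "real \<Rightarrow> real \<Rightarrow> nat set" where
  "bad_primes_level C\<^sub>0 X = {p. prime p \<and> real p > exp (exp (exp 1)) \<and> X / 2 < real p \<and> real p < X \<and>
       (\<exists>k a u. lrs k a u \<and> nondegenerate u \<and> of_int (lrs_height k a u) > C\<^sub>0 \<and> small_at X k a u \<and>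
         (\<exists>s \<alpha> Q. root_enumeration k a s \<alpha> \<and> exp_poly_form k a u s \<alpha> Q \<and>
           (\<exists>\<sigma> m. \<sigma> permutes {1..s} \<and> real m \<le> X powr (1/4) \<and> lrs_v k a s \<alpha> Q m \<sigma> \<noteq> 0 \<and>
             (\<exists>N::int. field_norm (adjoin (lrs_roots k a)) (lrs_v k a s \<alpha> Q m \<sigma>) = of_int N \<and>
                int p dvd N))))}"

lemma bad_prime_iff_level: "bad_prime C\<^sub>0 p \<longleftrightarrow> (\<exists>e. p \<in> bad_primes_level C\<^sub>0 (2 ^ e))"
proof -
  have ex: "(\<exists>X. (\<exists>e::nat. X = 2 ^ e) \<and> R X) \<longleftrightarrow> (\<exists>e. R (2 ^ e))" for R :: "real \<Rightarrow> bool"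
    by blast
  show ?thesis
    unfolding bad_prime_def bad_primes_level_def mem_Collect_eq ex by (simp only: ex_simps)
qed

lemma
  assumes C0: "C\<^sub>0 \<ge> 12"
  shows finite_bad_primes_level: "finite (bad_primes_level C\<^sub>0 X)"
    and card_bad_primes_level: "X \<ge> 1 \<Longrightarrow> real (card (bad_primes_level C\<^sub>0 X)) \<le> 4 * ln X * sqrt X"
proof -
  have "finite (bad_primes_level C\<^sub>0 X) \<and>
      (X \<ge> 1 \<longrightarrow> real (card (bad_primes_level C\<^sub>0 X)) \<le> 4 * ln X * sqrt X)"
  proof (cases "bad_primes_level C\<^sub>0 X = {}")
    case True
    then show ?thesis by simp
  next
    case False
    define L where "L = ln (ln X) / (10 * ln (ln (ln X)))"
    \<comment> \<open>A member of a nonempty level forces X above the threshold, and its recurrence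
      has height between C0 and L, which forces L > 12.\<close>
    obtain p k a u where "exp (exp (exp 1)) < real p" "real p < X"
      "of_int (lrs_height k a u) > C\<^sub>0" "small_at X k a u"
      using False unfolding bad_primes_level_def by blast
    then have X: "X > exp (exp (exp 1))" and L: "L > 12"
      using C0 by (auto simp: small_at_def L_def)
    have "X > 1" using X less_trans[of 1 "exp (exp (exp 1))" X] by simp
    define h where "h = nat \<lfloor>L\<rfloor>"
    define M where "M = nat \<lfloor>X powr (1/4)\<rfloor>"
    have h: "h \<ge> 12" using L unfolding h_def by (simp add: le_nat_iff le_floor_iff)
    have hL: "real h \<le> L" using L unfolding h_def by (simp add: of_nat_nat)
    have MX: "real M \<le> X powr (1/4)" unfolding M_def by (simp add: of_nat_nat)
    have sub: "bad_primes_level C\<^sub>0 X \<subseteq> norm_primes_upto h M"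
    proof
      fix p assume "p \<in> bad_primes_level C\<^sub>0 X"
      then obtain k a u s \<alpha> Q \<sigma> m N where p: "prime p" "lrs k a u" "small_at X k a u"
        "root_enumeration k a s \<alpha>" "exp_poly_form k a u s \<alpha> Q" "\<sigma> permutes {1..s}"
        "real m \<le> X powr (1/4)" "lrs_v k a s \<alpha> Q m \<sigma> \<noteq> 0"
        "field_norm (adjoin (lrs_roots k a)) (lrs_v k a s \<alpha> Q m \<sigma>) = of_int N" "int p dvd N"
        unfolding bad_primes_level_def by blast
      have "of_int (lrs_height k a u) < L" using p(3) by (simp add: small_at_def L_def)
      then have H: "lrs_height k a u \<le> int h"
        using L unfolding h_def by (simp add: le_floor_iff)
      have m: "m \<le> M" using p(7) unfolding M_def by (simp add: le_nat_iff le_floor_iff)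
      show "p \<in> norm_primes_upto h M"
        using p(2) H m p(4,5,6,8,9,1,10) by (rule bad_prime_in_norm_primes_upto)
    qed
    have h2: "h \<ge> 2" using h by simp
    note fin = finite_norm_primes_upto[OF h2, of M]
    have "real (card (bad_primes_level C\<^sub>0 X)) \<le> real (card (norm_primes_upto h M))"
      using card_mono[OF fin sub] by simp
    also have "\<dots> \<le> real h ^ (10 * h) * (real M + 1) ^ 2"
      using card_norm_primes_upto[OF h2, of M] level_count_bound[OF h, of M]
      by (meson of_nat_mono order_trans)
    also have "\<dots> \<le> ln X * (4 * sqrt X)"
    proof (rule mult_mono)
      show "real h ^ (10 * h) \<le> ln X"
        using h hL unfolding L_def by (intro power_self_le_ln X) auto
      \<comment> \<open>This absorbs the 1 in M + 1 at the cost of a factor 2, whose square is the 4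
        in the bound.\<close>
      have "1 \<le> X powr (1/4)" using \<open>X > 1\<close> by (intro ge_one_powr_ge_zero) auto
      then have "(real M + 1) ^ 2 \<le> (2 * X powr (1/4)) ^ 2"
        using MX by (intro power_mono) auto
      also have "\<dots> = 4 * (X powr (1/4)) ^ 2" by simp
      also have "(X powr (1/4)) ^ 2 = sqrt X"
        using \<open>X > 1\<close> by (simp add: power2_eq_square powr_half_sqrt flip: powr_add)
      finally show "(real M + 1) ^ 2 \<le> 4 * sqrt X" .
    qed (use \<open>X > 1\<close> in auto)
    finally show ?thesis using finite_subset[OF sub fin] by (simp only: mult_ac simp_thms)
  qed
  then show "finite (bad_primes_level C\<^sub>0 X)"
    "X \<ge> 1 \<Longrightarrow> real (card (bad_primes_level C\<^sub>0 X)) \<le> 4 * ln X * sqrt X" by simp_all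
qed

section \<open>Summation over the levels and the limit\<close>

text \<open>A prime p <= Y of level X satisfies X < 2 p <= 2 Y, so at most log 2 (2 * Y) + 1 dyadic
  levels contribute, and each is bounded by the estimate at 2 * Y.\<close>

lemma card_bad_primes_le:
  fixes Y :: real
  assumes C0: "C\<^sub>0 \<ge> 12" and Y: "Y \<ge> 1"
  shows "real (card {p \<in> bad_primes C\<^sub>0. real p \<le> Y}) \<le> (log 2 (2 * Y) + 1) * (4 * ln (2 * Y) * sqrt (2 * Y))"
proof -
  define E where "E = nat \<lfloor>log 2 (2 * Y)\<rfloor>"
  define b where "b = 4 * ln (2 * Y) * sqrt (2 * Y)"
  have EY: "real E \<le> log 2 (2 * Y)" using Y unfolding E_def by (simp add: of_nat_nat)
  have "2 powr real E \<le> 2 powr log 2 (2 * Y)" using EY by (intro powr_mono) auto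
  then have E2: "2 ^ E \<le> 2 * Y" using Y by (simp add: powr_realpow)
  have sub: "{p \<in> bad_primes C\<^sub>0. real p \<le> Y} \<subseteq> (\<Union>e\<in>{..E}. bad_primes_level C\<^sub>0 (2 ^ e))"
  proof safe
    fix p assume "p \<in> bad_primes C\<^sub>0" and pY: "real p \<le> Y"
    \<comment> \<open>The level is the witness inside \<open>bad_prime\<close>, not the index of the
      union in \<open>bad_primes\<close>.\<close>
    then obtain e where e: "p \<in> bad_primes_level C\<^sub>0 (2 ^ e)"
      by (auto simp: bad_primes_def bad_primes_at_def bad_prime_iff_level)
    then have "2 ^ e < 2 * Y" using pY by (auto simp: bad_primes_level_def)
    then have "real e \<le> log 2 (2 * Y)"
      using Y by (subst le_log_iff) (auto simp: powr_realpow)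
    then have "e \<le> E" unfolding E_def by (simp add: le_nat_iff le_floor_iff)
    then show "p \<in> (\<Union>e\<in>{..E}. bad_primes_level C\<^sub>0 (2 ^ e))" using e by blast
  qed
  have "card {p \<in> bad_primes C\<^sub>0. real p \<le> Y} \<le> card (\<Union>e\<in>{..E}. bad_primes_level C\<^sub>0 (2 ^ e))"
    using sub by (intro card_mono) (auto intro: finite_bad_primes_level[OF C0])
  also have "\<dots> \<le> (\<Sum>e\<le>E. card (bad_primes_level C\<^sub>0 (2 ^ e)))"
    by (intro card_UN_le) auto
  finally have "real (card {p \<in> bad_primes C\<^sub>0. real p \<le> Y}) \<le> (\<Sum>e\<le>E. real (card (bad_primes_level C\<^sub>0 (2 ^ e))))"
    by (simp flip: of_nat_sum)
  also have "\<dots> \<le> (\<Sum>e\<le>E. b)"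
  proof (rule sum_mono)
    fix e assume "e \<in> {..E}"
    then have "(2::real) ^ e \<le> 2 ^ E" by (intro power_increasing) auto
    then have e: "(2::real) ^ e \<le> 2 * Y" using E2 by linarith
    have "real (card (bad_primes_level C\<^sub>0 (2 ^ e))) \<le> 4 * ln (2 ^ e) * sqrt (2 ^ e)"
      by (intro card_bad_primes_level C0) auto
    also have "\<dots> \<le> b"
      unfolding b_def using e Y by (intro mult_mono) (auto simp: ln_ge_zero)
    finally show "real (card (bad_primes_level C\<^sub>0 (2 ^ e))) \<le> b" .
  qed
  also have "\<dots> = (real E + 1) * b" by (simp add: algebra_simps)
  also have "\<dots> \<le> (log 2 (2 * Y) + 1) * b"
    using EY Y unfolding b_def by (intro mult_right_mono) auto
  finally show ?thesis unfolding b_def .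
qed

text \<open>The constant is 3 here because rounding Y down to n costs up to 1 on top of the 2 in
  \<open>card_primes_lower_bound\<close>.\<close>

lemma card_primes_real_lower_bound:
  fixes Y :: real
  assumes "Y > 3"
  shows "(Y - 3) * ln 2 / ln Y \<le> real (card {p. prime p \<and> real p \<le> Y})"
proof -
  define n where "n = nat \<lfloor>Y\<rfloor>"
  have n: "real n \<le> Y" "Y < real n + 1" using assms unfolding n_def by linarith+
  have eq: "{p. prime p \<and> real p \<le> Y} = {p. prime p \<and> p \<le> n}"
    using assms unfolding n_def by (auto simp: le_nat_iff le_floor_iff)
  have "(Y - 3) * ln 2 \<le> (real n - 2) * ln 2"
    using n by (intro mult_right_mono) auto
  also have "\<dots> \<le> real (card {p. prime p \<and> p \<le> n}) * ln (real n)"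
    using n assms by (intro card_primes_lower_bound) linarith
  also have "\<dots> \<le> real (card {p. prime p \<and> p \<le> n}) * ln Y"
    using n assms by (intro mult_left_mono) auto
  finally show ?thesis using assms eq by (simp add: divide_le_eq)
qed

theorem mainTheorem1:
  fixes C\<^sub>0 :: real
  assumes "C\<^sub>0 \<ge> 12"
  shows "((\<lambda>X::real. real (card {p \<in> good_primes C\<^sub>0. real p \<le> X}) /
                      real (card {p::nat. prime p \<and> real p \<le> X})) \<longlongrightarrow> 1) at_top"
proof -
  define P where "P = (\<lambda>X::real. {p::nat. prime p \<and> real p \<le> X})"
  define B where "B = (\<lambda>X::real. {p \<in> bad_primes C\<^sub>0. real p \<le> X})"
  \<comment> \<open>The bound for the bad primes divided by the lower bound for all primes; it has
    order (log X)^3 / sqrt X.\<close>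
  define g where "g = (\<lambda>X::real. (log 2 (2 * X) + 1) * (4 * ln (2 * X) * sqrt (2 * X)) / ((X - 3) * ln 2 / ln X))"
  have fin: "finite (P X)" for X
    by (rule finite_subset[of _ "{..nat \<lfloor>X\<rfloor>}"]) (auto simp: P_def le_nat_floor)
  have BP: "B X \<subseteq> P X" for X
    by (auto simp: B_def P_def bad_primes_def bad_primes_at_def bad_prime_def)
  have g0: "(g \<longlongrightarrow> 0) at_top"
    unfolding g_def log_def by real_asymp
  have bounds: "1 - g X \<le> real (card {p \<in> good_primes C\<^sub>0. real p \<le> X}) / real (card (P X)) \<and>
      real (card {p \<in> good_primes C\<^sub>0. real p \<le> X}) / real (card (P X)) \<le> 1" if "X > 3" for X
  proof -
    have pos: "(X - 3) * ln 2 / ln X > 0" using that by simp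
    have lower: "(X - 3) * ln 2 / ln X \<le> real (card (P X))"
      unfolding P_def using that by (rule card_primes_real_lower_bound)
    then have P0: "real (card (P X)) > 0" using pos by linarith
    have "{p \<in> good_primes C\<^sub>0. real p \<le> X} = P X - B X"
      by (auto simp: good_primes_def P_def B_def)
    then have c: "real (card {p \<in> good_primes C\<^sub>0. real p \<le> X}) = real (card (P X)) - real (card (B X))"
      using card_Diff_subset[OF finite_subset[OF BP fin] BP, of X] card_mono[OF fin BP, of X]
      by simp
    have "real (card (B X)) / real (card (P X)) \<le> g X"
      unfolding g_def using card_bad_primes_le[OF assms, of X] that lower pos
      by (intro frac_le) (auto simp: B_def)
    then show ?thesis using P0 unfolding c by (simp add: diff_divide_distrib)
  qed
  have lim: "((\<lambda>X. 1 - g X) \<longlongrightarrow> 1) at_top"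
    using tendsto_diff[OF tendsto_const g0, of 1] by simp
  have lower: "\<forall>\<^sub>F X in at_top. 1 - g X \<le> real (card {p \<in> good_primes C\<^sub>0. real p \<le> X}) / real (card (P X))"
    and upper: "\<forall>\<^sub>F X in at_top. real (card {p \<in> good_primes C\<^sub>0. real p \<le> X}) / real (card (P X)) \<le> 1"
    by (rule eventually_mono[OF eventually_gt_at_top[of 3]], drule bounds, erule conjunct1 conjunct2)+
  show ?thesis
    using tendsto_sandwich[OF lower upper lim tendsto_const] unfolding P_def .
qed

end
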